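(* ${\sf ITL}^0_{\Diamond\forall}$ is complete for $\mathbb Q$: if $\varphi\in\mathcal L_{\Diamond\forall}$ is valid on every dynamical system of the form $(\mathbb Q,f)$, where $\mathbb Q$ carries its usual topology and $f\colon\mathbb Q\to\mathbb Q$ is continuous, then $\varphi\in{\sf ITL}^0_{\Diamond\forall}$.
   Context: Syntax: fix a countably infinite set $\mathbb P$ of propositional variables. $\mathcal L_{\Diamond\forall}$ is given by $\varphi ::= \bot \mid p \mid \varphi\wedge\varphi \mid \varphi\vee\varphi \mid \varphi\to\varphi \mid \circ\varphi \mid \Diamond\varphi \mid \forall\varphi$; $\neg\varphi:=\varphi\to\bot$, $\varphi\leftrightarrow\psi:=(\varphi\to\psi)\wedge(\psi\to\varphi)$. Semantics: a dynamical system is $(X,\mathcal T,f)$ with $f$ continuous. A valuation assigns to each formula an open set with $[\![\bot]\!]=\varnothing$, $[\![\varphi\wedge\psi]\!]=[\![\varphi]\!]\cap[\![\psi]\!]$, $[\![\varphi\vee\psi]\!]=[\![\varphi]\!]\cup[\![\psi]\!]$, $[\![\varphi\to\psi]\!]=\big((X\setminus[\![\varphi]\!])\cup[\![\psi]\!]\big)^\circ$, $[\![\circ\varphi]\!]=f^{-1}[\![\varphi]\!]$, $[\![\Diamond\varphi]\!]=\bigcup_{n<\omega}f^{-n}[\![\varphi]\!]$, $[\![\forall\varphi]\!]=X$ if $[\![\varphi]\!]=X$ and $\varnothing$ otherwise. $\varphi$ is valid on a system if $[\![\varphi]\!]=X$ for every valuation. Logic: ${\sf ITL}^0_{\Diamond\forall}$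 is the least set of $\mathcal L_{\Diamond\forall}$-formulas containing all substitution instances of the axioms of intuitionistic propositional logic and of (N1) $\neg\circ\bot$, (N2) $\circ\varphi\wedge\circ\psi\to\circ(\varphi\wedge\psi)$, (N3) $\circ(\varphi\vee\psi)\to\circ\varphi\vee\circ\psi$, (N4) $\circ(\varphi\to\psi)\to(\circ\varphi\to\circ\psi)$, (E1) $\varphi\vee\circ\Diamond\varphi\to\Diamond\varphi$, (UA1) $\forall\varphi\vee\neg\forall\varphi$, (UA2) $\forall(\varphi\to\psi)\to(\forall\varphi\to\forall\psi)$, (UA3) $\forall(\varphi\vee\forall\psi)\to\forall\varphi\vee\forall\psi$, (UA4) $\forall\varphi\to\varphi$, (UA5) $\forall\varphi\to\forall\forall\varphi$, (UA6) $\forall\varphi\leftrightarrow\circ\forall\varphi$, closed under modus ponens, from $\varphi$ infer $\circ\varphi$, from $\varphi\to\psi$ infer $\Diamond\varphi\to\Diamond\psi$, from $\circ\varphi\to\varphi$ infer $\Diamond\varphi\to\varphi$, and from $\varphi$ infer $\forall\varphi$. *)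

theory Defs
  imports "HOL-Analysis.Analysis"
begin

datatype fml =
    Bot
  | Var nat
  | And fml fml
  | Or fml fml
  | Imp fml fml
  | Next fml
  | Dia fml
  | All fml

definition Neg :: "fml \<Rightarrow> fml" where "Neg \<phi> = Imp \<phi> Bot"
definition Iff :: "fml \<Rightarrow> fml \<Rightarrow> fml" where "Iff \<phi> \<psi> = And (Imp \<phi> \<psi>) (Imp \<psi> \<phi>)"

fun sem :: "'a topology \<Rightarrow> ('a \<Rightarrow> 'a) \<Rightarrow> (nat \<Rightarrow> 'a set) \<Rightarrow> fml \<Rightarrow> 'a set" where
  "sem X f V Bot = {}"
| "sem X f V (Var p) = V p"
| "sem X f V (And a b) = sem X f V a \<inter> sem X f V b"
| "sem X f V (Or a b) = sem X f V a \<union> sem X f V b"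
| "sem X f V (Imp a b) = X interior_of ((topspace X - sem X f V a) \<union> sem X f V b)"
| "sem X f V (Next a) = {x \<in> topspace X. f x \<in> sem X f V a}"
| "sem X f V (Dia a) = (\<Union>n. {x \<in> topspace X. (f ^^ n) x \<in> sem X f V a})"
| "sem X f V (All a) = (if sem X f V a = topspace X then topspace X else {})"

definition dyn_system :: "'a topology \<Rightarrow> ('a \<Rightarrow> 'a) \<Rightarrow> bool" where
  "dyn_system X f \<longleftrightarrow> continuous_map X X f"

definition valid_on :: "'a topology \<Rightarrow> ('a \<Rightarrow> 'a) \<Rightarrow> fml \<Rightarrow> bool" where
  "valid_on X f \<phi> \<longleftrightarrow>
     (\<forall>V. (\<forall>p. openin X (V p)) \<longrightarrow> sem X f V \<phi> = topspace X)"

definition Qtop :: "real topology" where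
  "Qtop = subtopology euclideanreal \<rat>"

text \<open>The logic ITL^0 with diamond and universal modality. The intuitionistic
  propositional axioms are given by a standard Hilbert-style axiomatisation
  (all instances over the full language), so with modus ponens all substitution
  instances of IPC theorems are derivable.\<close>
inductive_set ITL0 :: "fml set" where
  ipc1: "Imp a (Imp b a) \<in> ITL0"
| ipc2: "Imp (Imp a (Imp b c)) (Imp (Imp a b) (Imp a c)) \<in> ITL0"
| ipc3: "Imp (And a b) a \<in> ITL0"
| ipc4: "Imp (And a b) b \<in> ITL0"
| ipc5: "Imp a (Imp b (And a b)) \<in> ITL0"
| ipc6: "Imp a (Or a b) \<in> ITL0"
| ipc7: "Imp b (Or a b) \<in> ITL0"
| ipc8: "Imp (Imp a c) (Imp (Imp b c) (Imp (Or a b) c)) \<in> ITL0"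
| ipc9: "Imp Bot a \<in> ITL0"
| N1: "Neg (Next Bot) \<in> ITL0"
| N2: "Imp (And (Next a) (Next b)) (Next (And a b)) \<in> ITL0"
| N3: "Imp (Next (Or a b)) (Or (Next a) (Next b)) \<in> ITL0"
| N4: "Imp (Next (Imp a b)) (Imp (Next a) (Next b)) \<in> ITL0"
| E1: "Imp (Or a (Next (Dia a))) (Dia a) \<in> ITL0"
| UA1: "Or (All a) (Neg (All a)) \<in> ITL0"
| UA2: "Imp (All (Imp a b)) (Imp (All a) (All b)) \<in> ITL0"
| UA3: "Imp (All (Or a (All b))) (Or (All a) (All b)) \<in> ITL0"
| UA4: "Imp (All a) a \<in> ITL0"
| UA5: "Imp (All a) (All (All a)) \<in> ITL0"
| UA6: "Iff (All a) (Next (All a)) \<in> ITL0"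
| MP: "a \<in> ITL0 \<Longrightarrow> Imp a b \<in> ITL0 \<Longrightarrow> b \<in> ITL0"
| NecNext: "a \<in> ITL0 \<Longrightarrow> Next a \<in> ITL0"
| MonDia: "Imp a b \<in> ITL0 \<Longrightarrow> Imp (Dia a) (Dia b) \<in> ITL0"
| IndDia: "Imp (Next a) a \<in> ITL0 \<Longrightarrow> Imp (Dia a) a \<in> ITL0"
| NecAll: "a \<in> ITL0 \<Longrightarrow> All a \<in> ITL0"

end

(* Completeness is proved by refuting a formula phi outside the logic.  Fix a prime theory omitting
   phi.  The formulas that it declares universally true form a logic over which the universal
   modality is decided, so that its prime theories, ordered by inclusion and with the successor
   {a. Next a : G}, give a canonical model of everything except the eventualities.  Each prime theory
   is replaced by the finite tree of the types (restrictions to the subformulas of phi) of its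
   extensions.  There are finitely many such trees, and being simulated by a tree is expressed by a
   formula; this lets the induction rule for Dia force every eventuality along some path of the
   nondeterministic successor relation on trees.

   The resulting finite quasimodel is unwound into a countable space of sequences of better and
   better approximations to successor paths, on which the shift is continuous.  Ordered
   lexicographically this space is a countable dense order without end points, hence homeomorphic
   to the rationals by Cantor's theorem. *)

theory Submission
  imports Defs "HOL-Library.FSet"
begin

section \<open>Prime theories\<close>

text \<open>There is no henceforth operator, and induction for \<open>Dia\<close> applies to
  theorems only, so a canonical prime theory may contain \<open>Dia a\<close> although no iterate of
  \<open>next_thy\<close> contains \<open>a\<close>. Such a defect can be excluded only by an
  invariant that is itself a formula, which is why worlds are collapsed to finitely many definable
  ones. Bare types would not do: confluence needs to know which larger types are still available
  above a world, and a tree records this. The price is that the successor is no longer a function.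
  Taking paths as points restores determinism, but \<open>Imp\<close> demands that each
  neighbourhood of a path starting at \<open>w\<close> contain points starting at every world above
  \<open>w\<close>. A path obtained by confluence stays above the given one but may leave
  eventualities unfulfilled, so it is followed for finitely many steps and then exchanged for a good
  one. Hence points are sequences of approximations that constrain one another on growing initial
  segments only. Prime theories are developed over an arbitrary \<open>L\<close>, because they are
  needed for \<open>ITL0\<close> and again for the logic of universally true formulas.\<close>

locale temporal_logic =
  fixes L :: "fml set"
  assumes ITL0_subset: "ITL0 \<subseteq> L"
    and mp: "a \<in> L \<Longrightarrow> Imp a b \<in> L \<Longrightarrow> b \<in> L"
    and nec_next: "a \<in> L \<Longrightarrow> Next a \<in> L"
    and mon_dia: "Imp a b \<in> L \<Longrightarrow> Imp (Dia a) (Dia b) \<in> L"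
    and ind_dia: "Imp (Next a) a \<in> L \<Longrightarrow> Imp (Dia a) a \<in> L"
begin

text \<open>The other rules preserve theoremhood but not truth at a world, so they are postulated
  for \<open>L\<close> alone and theories are closed under modus ponens only.\<close>

definition closed_thy :: "fml set \<Rightarrow> bool" where
  "closed_thy T \<longleftrightarrow> L \<subseteq> T \<and> (\<forall>a b. a \<in> T \<longrightarrow> Imp a b \<in> T \<longrightarrow> b \<in> T)"

definition prime_thys :: "fml set set" where
  "prime_thys = {T. closed_thy T \<and> Bot \<notin> T \<and> (\<forall>a b. Or a b \<in> T \<longrightarrow> a \<in> T \<or> b \<in> T)}"

definition next_thy :: "fml set \<Rightarrow> fml set" where
  "next_thy T = {a. Next a \<in> T}"

lemma closed_thyD: "closed_thy T \<Longrightarrow> a \<in> T \<Longrightarrow> Imp a b \<in> T \<Longrightarrow> b \<in> T"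
  unfolding closed_thy_def by blast

lemma closed_thy_ITL0: "closed_thy T \<Longrightarrow> a \<in> ITL0 \<Longrightarrow> a \<in> T"
  unfolding closed_thy_def using ITL0_subset by blast

lemma closed_thy_L: "closed_thy L"
  unfolding closed_thy_def using mp by blast

lemma closed_thy_axiom: "closed_thy T \<Longrightarrow> a \<in> T \<Longrightarrow> Imp a b \<in> ITL0 \<Longrightarrow> b \<in> T"
  using closed_thyD closed_thy_ITL0 by blast

lemma closed_thy_axiom2:
  "closed_thy T \<Longrightarrow> a \<in> T \<Longrightarrow> b \<in> T \<Longrightarrow> Imp a (Imp b c) \<in> ITL0 \<Longrightarrow> c \<in> T"
  using closed_thyD closed_thy_axiom by blast

lemma prime_thys_closed: "T \<in> prime_thys \<Longrightarrow> closed_thy T"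
  unfolding prime_thys_def by blast

text \<open>The deduction theorem in semantic dress: the set is the theory generated by
  \<open>T\<close> and \<open>b\<close>, closed under modus ponens by \<open>ipc2\<close>.\<close>

lemma closed_thy_extend:
  assumes T: "closed_thy T"
  shows "closed_thy {d. Imp b d \<in> T}" "T \<subseteq> {d. Imp b d \<in> T}" "b \<in> {d. Imp b d \<in> T}"
proof -
  show sub: "T \<subseteq> {d. Imp b d \<in> T}"
    using closed_thy_axiom[OF T _ ipc1] by blast
  show "closed_thy {d. Imp b d \<in> T}"
    unfolding closed_thy_def
  proof (intro conjI allI impI)
    show "L \<subseteq> {d. Imp b d \<in> T}" using sub T unfolding closed_thy_def by blast
    fix a c assume "a \<in> {d. Imp b d \<in> T}" "Imp a c \<in> {d. Imp b d \<in> T}"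
    then show "c \<in> {d. Imp b d \<in> T}"
      using closed_thy_axiom2[OF T _ _ ipc2] by blast
  qed
  \<comment> \<open>The usual derivation of \<open>Imp b b\<close> from two instances of
    \<open>ipc1\<close> and one of \<open>ipc2\<close>.\<close>
  show "b \<in> {d. Imp b d \<in> T}"
    using closed_thy_ITL0[OF T MP[OF ipc1[of b b] MP[OF ipc1[of b "Imp b b"] ipc2]]] by blast
qed

lemma lindenbaum:
  assumes T: "closed_thy T" and a: "a \<notin> T"
  obtains G where "G \<in> prime_thys" "T \<subseteq> G" "a \<notin> G"
proof -
  let ?A = "{S. closed_thy S \<and> T \<subseteq> S \<and> a \<notin> S}"
  have "\<exists>M\<in>?A. \<forall>X\<in>?A. M \<subseteq> X \<longrightarrow> X = M"
  proof (rule subset_Zorn_nonempty)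
    show "?A \<noteq> {}" using T a by blast
    fix C assume C: "C \<noteq> {}" "subset.chain ?A C"
    have CA: "closed_thy S" "T \<subseteq> S" "a \<notin> S" if "S \<in> C" for S
      using C(2) that unfolding subset_chain_def by auto
    have CC: "S1 \<subseteq> S2 \<or> S2 \<subseteq> S1" if "S1 \<in> C" "S2 \<in> C" for S1 S2
      using C(2) that unfolding subset_chain_def by blast
    obtain S0 where S0: "S0 \<in> C" using C(1) by blast
    have "closed_thy (\<Union>C)"
      unfolding closed_thy_def
    proof (intro conjI allI impI)
      show "L \<subseteq> \<Union>C" using CA(1)[OF S0] S0 unfolding closed_thy_def by blast
      fix x y assume "x \<in> \<Union>C" "Imp x y \<in> \<Union>C"
      then obtain S1 S2 where S: "S1 \<in> C" "S2 \<in> C" "x \<in> S1" "Imp x y \<in> S2" by blast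
      then obtain S where "S \<in> C" "x \<in> S" "Imp x y \<in> S" using CC[OF S(1,2)] by blast
      then show "y \<in> \<Union>C" using closed_thyD[OF CA(1)] by blast
    qed
    moreover have "T \<subseteq> \<Union>C" using CA(2)[OF S0] S0 by blast
    moreover have "a \<notin> \<Union>C" using CA(3) by blast
    ultimately show "\<Union>C \<in> ?A" by blast
  qed
  then obtain G where GA: "G \<in> ?A" and max: "\<forall>X\<in>?A. G \<subseteq> X \<longrightarrow> X = G" by (rule bexE)
  then have G: "closed_thy G" "T \<subseteq> G" "a \<notin> G" by simp_all
  \<comment> \<open>Maximality: adding any missing \<open>b\<close> must yield \<open>a\<close>. If
    both disjuncts were missing, \<open>ipc8\<close> would therefore derive \<open>a\<close> from
    the disjunction.\<close>
  have step: "Imp b a \<in> G" if b: "b \<notin> G" for b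
  proof (rule ccontr)
    note c = closed_thy_extend[OF G(1), of b]
    assume "Imp b a \<notin> G"
    then have "{d. Imp b d \<in> G} \<in> ?A" using c(1) subset_trans[OF G(2) c(2)] by simp
    then have "{d. Imp b d \<in> G} = G" using max c(2) by simp
    then show False using c(3) b by simp
  qed
  have "Bot \<notin> G" using closed_thy_axiom[OF G(1) _ ipc9] G(3) by blast
  moreover have "b \<in> G \<or> c \<in> G" if bc: "Or b c \<in> G" for b c
  proof (rule ccontr)
    assume "\<not> (b \<in> G \<or> c \<in> G)"
    then have "Imp (Or b c) a \<in> G"
      using closed_thy_axiom2[OF G(1) _ _ ipc8] step by blast
    then show False using closed_thyD[OF G(1) bc] G(3) by blast
  qed
  ultimately have "G \<in> prime_thys" unfolding prime_thys_def using G(1) by blast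
  then show thesis using that G by blast
qed

lemma in_L_iff: "a \<in> L \<longleftrightarrow> (\<forall>G\<in>prime_thys. a \<in> G)"
proof
  assume "a \<in> L"
  then show "\<forall>G\<in>prime_thys. a \<in> G" using prime_thys_closed unfolding closed_thy_def by blast
next
  assume R: "\<forall>G\<in>prime_thys. a \<in> G"
  show "a \<in> L"
  proof (rule ccontr)
    assume "a \<notin> L"
    then obtain G where "G \<in> prime_thys" "a \<notin> G" using lindenbaum[OF closed_thy_L] by metis
    then show False using R by blast
  qed
qed

context
  fixes G assumes G: "G \<in> prime_thys"
begin

lemma prime_Bot: "Bot \<notin> G"
  using G unfolding prime_thys_def by blast

lemma prime_And: "And a b \<in> G \<longleftrightarrow> a \<in> G \<and> b \<in> G"
  using closed_thy_axiom[OF prime_thys_closed[OF G]] closed_thy_axiom2[OF prime_thys_closed[OF G]]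
    ipc3 ipc4 ipc5 by blast

lemma prime_Or: "Or a b \<in> G \<longleftrightarrow> a \<in> G \<or> b \<in> G"
  using closed_thy_axiom[OF prime_thys_closed[OF G]] ipc6 ipc7 G unfolding prime_thys_def by blast

lemma prime_Imp: "Imp a b \<in> G \<longleftrightarrow> (\<forall>D\<in>prime_thys. G \<subseteq> D \<longrightarrow> a \<in> D \<longrightarrow> b \<in> D)"
proof
  assume "Imp a b \<in> G"
  then show "\<forall>D\<in>prime_thys. G \<subseteq> D \<longrightarrow> a \<in> D \<longrightarrow> b \<in> D"
    using closed_thyD prime_thys_closed by blast
next
  assume R: "\<forall>D\<in>prime_thys. G \<subseteq> D \<longrightarrow> a \<in> D \<longrightarrow> b \<in> D"
  note c = closed_thy_extend[OF prime_thys_closed[OF G], of a]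
  show "Imp a b \<in> G"
  proof (rule ccontr)
    assume "Imp a b \<notin> G"
    then obtain D where "D \<in> prime_thys" "{d. Imp a d \<in> G} \<subseteq> D" "b \<notin> D"
      using lindenbaum[OF c(1), of b] by (metis mem_Collect_eq)
    then show False using R c by blast
  qed
qed

text \<open>N4 gives closure under modus ponens, N1 consistency and N3 primality, so on prime
  theories the successor is a genuine function.\<close>

lemma prime_next: "next_thy G \<in> prime_thys"
proof -
  note c = prime_thys_closed[OF G]
  have "closed_thy (next_thy G)"
    unfolding closed_thy_def next_thy_def
    using c closed_thy_axiom2[OF c _ _ N4] nec_next unfolding closed_thy_def by blast
  moreover have "Next Bot \<notin> G"
    using closed_thyD[OF c] closed_thy_ITL0[OF c N1] prime_Bot unfolding Neg_def by blast
  moreover have "Next a \<in> G \<or> Next b \<in> G" if "Next (Or a b) \<in> G" for a b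
    using closed_thy_axiom[OF c that N3] prime_Or by blast
  ultimately show ?thesis unfolding prime_thys_def next_thy_def by blast
qed

end

lemma prime_mp: "G \<in> prime_thys \<Longrightarrow> Imp a b \<in> G \<Longrightarrow> a \<in> G \<Longrightarrow> b \<in> G"
  using closed_thyD prime_thys_closed by blast

lemma Imp_in_L: "Imp a b \<in> L \<longleftrightarrow> (\<forall>G\<in>prime_thys. a \<in> G \<longrightarrow> b \<in> G)"
  using in_L_iff prime_Imp by (meson order_refl)

lemma prime_ITL0_Imp: "G \<in> prime_thys \<Longrightarrow> Imp a b \<in> ITL0 \<Longrightarrow> a \<in> G \<Longrightarrow> b \<in> G"
  using closed_thy_axiom prime_thys_closed by blast

lemma in_next_thy: "a \<in> next_thy G \<longleftrightarrow> Next a \<in> G"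
  unfolding next_thy_def by simp

lemma next_thy_mono: "G \<subseteq> D \<Longrightarrow> next_thy G \<subseteq> next_thy D"
  unfolding next_thy_def by blast

lemma prime_Dia_mono:
  assumes "\<And>D. D \<in> prime_thys \<Longrightarrow> a \<in> D \<Longrightarrow> b \<in> D" "G \<in> prime_thys" "Dia a \<in> G"
  shows "Dia b \<in> G"
  using assms mon_dia[of a b] unfolding Imp_in_L by blast

text \<open>The induction rule read over prime theories: its premise is checked world by world,
  which replaces Hilbert-style derivations from here on.\<close>

lemma prime_Dia_ind:
  assumes "\<And>D. D \<in> prime_thys \<Longrightarrow> a \<in> next_thy D \<Longrightarrow> a \<in> D" "G \<in> prime_thys" "Dia a \<in> G"
  shows "a \<in> G"
  using assms ind_dia[of a] unfolding Imp_in_L in_next_thy by blast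

lemma prime_Dia_intro: "G \<in> prime_thys \<Longrightarrow> a \<in> G \<or> Dia a \<in> next_thy G \<Longrightarrow> Dia a \<in> G"
  using prime_ITL0_Imp[OF _ E1, of G a] prime_Or in_next_thy by blast

text \<open>The converse of E1 is not an axiom. It follows by induction because
  \<open>Or a (Next (Dia a))\<close> is implied by \<open>a\<close> and passes from a successor back
  to its predecessor.\<close>

lemma prime_Dia:
  assumes G: "G \<in> prime_thys"
  shows "Dia a \<in> G \<longleftrightarrow> a \<in> G \<or> Dia a \<in> next_thy G"
proof
  let ?c = "Or a (Next (Dia a))"
  assume "Dia a \<in> G"
  then have "Dia ?c \<in> G" by (rule prime_Dia_mono[rotated 2]) (use G prime_Or in blast)+
  then have "?c \<in> G"
  proof (rule prime_Dia_ind[rotated 2])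
    fix D assume D: "D \<in> prime_thys" "?c \<in> next_thy D"
    have "Dia a \<in> next_thy D"
      using D prime_next[OF D(1)] prime_Or[OF prime_next[OF D(1)]] in_next_thy prime_Dia_intro
      by blast
    then show "?c \<in> D" using prime_Or[OF D(1)] in_next_thy by blast
  qed (rule G)
  then show "a \<in> G \<or> Dia a \<in> next_thy G" using prime_Or[OF G] in_next_thy by blast
qed (rule prime_Dia_intro[OF G])

lemma prime_finite_conj:
  assumes "finite F"
  shows "\<exists>c. \<forall>G\<in>prime_thys. c \<in> G \<longleftrightarrow> F \<subseteq> G"
  using assms
proof induction
  case empty
  have "Imp Bot Bot \<in> ITL0" by (rule ipc9)
  then show ?case using closed_thy_ITL0 prime_thys_closed by blast
next
  case (insert a F)
  then obtain c where "\<forall>G\<in>prime_thys. c \<in> G \<longleftrightarrow> F \<subseteq> G" by blast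
  then have "\<forall>G\<in>prime_thys. And a c \<in> G \<longleftrightarrow> insert a F \<subseteq> G" using prime_And by simp
  then show ?case by blast
qed

lemma prime_finite_disj:
  assumes "finite F"
  shows "\<exists>c. \<forall>G\<in>prime_thys. c \<in> G \<longleftrightarrow> F \<inter> G \<noteq> {}"
  using assms
proof induction
  case empty
  then show ?case using prime_Bot by blast
next
  case (insert a F)
  then obtain c where "\<forall>G\<in>prime_thys. c \<in> G \<longleftrightarrow> F \<inter> G \<noteq> {}" by blast
  then have "\<forall>G\<in>prime_thys. Or a c \<in> G \<longleftrightarrow> insert a F \<inter> G \<noteq> {}" using prime_Or by auto
  then show ?case by blast
qed

end

section \<open>The logic of universally true formulas\<close>

interpretation ITL0: temporal_logic ITL0
  by unfold_locales (auto intro: ITL0.intros)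

lemma ITL0_All_next:
  assumes "G \<in> ITL0.prime_thys" "All a \<in> G"
  shows "All a \<in> ITL0.next_thy G"
proof -
  have "Imp (All a) (Next (All a)) \<in> ITL0"
    by (rule MP[OF UA6[unfolded Iff_def] ipc3])
  then show ?thesis using assms ITL0.prime_ITL0_Imp ITL0.in_next_thy by blast
qed

lemma ITL0_All_mono:
  assumes "\<And>D. D \<in> ITL0.prime_thys \<Longrightarrow> a \<in> D \<Longrightarrow> b \<in> D" "G \<in> ITL0.prime_thys" "All a \<in> G"
  shows "All b \<in> G"
proof -
  have "All (Imp a b) \<in> ITL0" using NecAll ITL0.Imp_in_L assms(1) by blast
  then have "Imp (All a) (All b) \<in> ITL0" using MP UA2 by blast
  then show ?thesis using assms ITL0.prime_ITL0_Imp by blast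
qed

text \<open>Relative to a prime theory, the universally true formulas form a logic that decides every
  formula starting with the universal modality; over it the universal modality behaves like a
  propositional constant.\<close>

lemma universal_logic:
  assumes "\<phi> \<notin> ITL0"
  obtains L where "temporal_logic L" "\<phi> \<notin> L"
    "\<And>a G. G \<in> temporal_logic.prime_thys L \<Longrightarrow> All a \<in> G \<longleftrightarrow> a \<in> L"
proof -
  obtain G0 where G0: "G0 \<in> ITL0.prime_thys" "\<phi> \<notin> G0"
    using assms ITL0.lindenbaum[OF ITL0.closed_thy_L] by metis
  define L where "L = {a. All a \<in> G0}"
  have All_elim: "a \<in> G" if "G \<in> ITL0.prime_thys" "All a \<in> G" for a G
    using ITL0.prime_ITL0_Imp[OF _ UA4] that by blast
  have All_mp: "b \<in> L" if "a \<in> L" "Imp a b \<in> L" for a b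
    using that ITL0.closed_thy_axiom2[OF ITL0.prime_thys_closed[OF G0(1)] _ _ UA2] unfolding L_def by blast
  have All_ITL0: "a \<in> L" if "a \<in> ITL0" for a
    using that NecAll ITL0.in_L_iff G0(1) unfolding L_def by blast
  have All_All: "All (All a) \<in> G" if "G \<in> ITL0.prime_thys" "All a \<in> G" for a G
    using ITL0.prime_ITL0_Imp[OF _ UA5] that by blast
  \<comment> \<open>By UA5 truth of \<open>All a\<close> is itself universal, so whatever follows
    from \<open>All a\<close> in all prime theories is universally true. Each closure condition
    below reduces to this.\<close>
  have mono: "b \<in> L" if "a \<in> L" "\<And>D. D \<in> ITL0.prime_thys \<Longrightarrow> All a \<in> D \<Longrightarrow> b \<in> D" for a b
    using ITL0_All_mono[of "All a" b G0] All_All G0(1) that unfolding L_def by blast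
  have "temporal_logic L"
  proof
    show "ITL0 \<subseteq> L" using All_ITL0 by blast
    show "b \<in> L" if "a \<in> L" "Imp a b \<in> L" for a b using All_mp that .
    show "Next a \<in> L" if "a \<in> L" for a
    proof (rule mono[OF that])
      fix D assume "D \<in> ITL0.prime_thys" "All a \<in> D"
      then have "a \<in> ITL0.next_thy D" using All_elim ITL0_All_next ITL0.prime_next by blast
      then show "Next a \<in> D" using ITL0.in_next_thy by blast
    qed
    show "Imp (Dia a) (Dia b) \<in> L" if "Imp a b \<in> L" for a b
    proof (rule mono[OF that])
      let ?u = "All (Imp a b)"
      \<comment> \<open>The rules of \<open>ITL0\<close> cannot be used under the assumption
        \<open>?u\<close>, so the assumption is built into the formula to which they are applied. It
        survives a step by UA6, through \<open>ITL0_All_next\<close>.\<close>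
      let ?c = "Imp ?u (Dia b)"
      fix D assume D: "D \<in> ITL0.prime_thys" "?u \<in> D"
      have "Dia b \<in> D'" if D': "D' \<in> ITL0.prime_thys" "D \<subseteq> D'" "Dia a \<in> D'" for D'
      proof -
        have "Dia ?c \<in> D'"
        proof (rule ITL0.prime_Dia_mono[OF _ D'(1,3)])
          fix H assume H: "H \<in> ITL0.prime_thys" "a \<in> H"
          show "?c \<in> H" unfolding ITL0.prime_Imp[OF H(1)]
          proof (intro ballI impI)
            fix K assume K: "K \<in> ITL0.prime_thys" "H \<subseteq> K" "?u \<in> K"
            then have "b \<in> K" using ITL0.prime_mp[OF K(1) All_elim[OF K(1,3)]] H(2) by blast
            then show "Dia b \<in> K" using ITL0.prime_Dia_intro K(1) by blast
          qed
        qed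
        then have "?c \<in> D'"
        proof (rule ITL0.prime_Dia_ind[OF _ D'(1), rotated])
          fix H assume H: "H \<in> ITL0.prime_thys" "?c \<in> ITL0.next_thy H"
          show "?c \<in> H" unfolding ITL0.prime_Imp[OF H(1)]
          proof (intro ballI impI)
            fix K assume K: "K \<in> ITL0.prime_thys" "H \<subseteq> K" "?u \<in> K"
            have "?c \<in> ITL0.next_thy K" using H K ITL0.next_thy_mono by blast
            then have "Dia b \<in> ITL0.next_thy K"
              using ITL0.prime_mp[OF ITL0.prime_next[OF K(1)]] ITL0_All_next[OF K(1,3)] by blast
            then show "Dia b \<in> K" using ITL0.prime_Dia_intro K(1) by blast
          qed
        qed
        then show ?thesis using ITL0.prime_mp[OF D'(1)] D(2) D'(2) by blast
      qed
      then show "Imp (Dia a) (Dia b) \<in> D" using ITL0.prime_Imp[OF D(1)] by blast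
    qed
    show "Imp (Dia a) a \<in> L" if "Imp (Next a) a \<in> L" for a
    proof (rule mono[OF that])
      let ?u = "All (Imp (Next a) a)"
      \<comment> \<open>As for monotonicity: the relativised formula \<open>?c\<close> satisfies the
        premise of the induction rule outright.\<close>
      let ?c = "Imp ?u a"
      fix D assume D: "D \<in> ITL0.prime_thys" "?u \<in> D"
      have "a \<in> D'" if D': "D' \<in> ITL0.prime_thys" "D \<subseteq> D'" "Dia a \<in> D'" for D'
      proof -
        have "Dia ?c \<in> D'"
          by (rule ITL0.prime_Dia_mono[OF _ D'(1,3)]) (use ITL0.prime_ITL0_Imp[OF _ ipc1] in blast)
        then have "?c \<in> D'"
        proof (rule ITL0.prime_Dia_ind[OF _ D'(1), rotated])
          fix H assume H: "H \<in> ITL0.prime_thys" "?c \<in> ITL0.next_thy H"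
          show "?c \<in> H" unfolding ITL0.prime_Imp[OF H(1)]
          proof (intro ballI impI)
            fix K assume K: "K \<in> ITL0.prime_thys" "H \<subseteq> K" "?u \<in> K"
            have "?c \<in> ITL0.next_thy K" using H K ITL0.next_thy_mono by blast
            then have "a \<in> ITL0.next_thy K"
              using ITL0.prime_mp[OF ITL0.prime_next[OF K(1)]] ITL0_All_next[OF K(1,3)] by blast
            then show "a \<in> K"
              using ITL0.prime_mp[OF K(1) All_elim[OF K(1,3)]] ITL0.in_next_thy by blast
          qed
        qed
        then show ?thesis using ITL0.prime_mp[OF D'(1)] D(2) D'(2) by blast
      qed
      then show "Imp (Dia a) a \<in> D" using ITL0.prime_Imp[OF D(1)] by blast
    qed
  qed
  then interpret L: temporal_logic L .
  have yes: "All a \<in> L" if "a \<in> L" for a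
    using that All_All G0(1) unfolding L_def by blast
  have no: "Neg (All a) \<in> L" if "a \<notin> L" for a
  proof -
    \<comment> \<open>UA1 with its disjuncts exchanged, so that after necessitation UA3 can
      distribute the outer \<open>All\<close> over the disjunction.\<close>
    have "Or (Neg (All a)) (All a) \<in> D" if "D \<in> ITL0.prime_thys" for D
      using ITL0.prime_Or[OF that] UA1 ITL0.in_L_iff that by blast
    then have "All (Or (Neg (All a)) (All a)) \<in> ITL0" using ITL0.in_L_iff NecAll by blast
    then have "Or (All (Neg (All a))) (All a) \<in> G0"
      using UA3 MP ITL0.in_L_iff G0(1) by blast
    then show ?thesis using that ITL0.prime_Or[OF G0(1)] unfolding L_def by blast
  qed
  have "All a \<in> G \<longleftrightarrow> a \<in> L" if G: "G \<in> L.prime_thys" for a G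
  proof (cases "a \<in> L")
    case True
    then show ?thesis using yes G L.in_L_iff by blast
  next
    case False
    then have "Imp (All a) Bot \<in> G" using no G L.in_L_iff unfolding Neg_def by blast
    then have "All a \<notin> G"
      using L.closed_thyD[OF L.prime_thys_closed[OF G]] L.prime_Bot[OF G] by blast
    then show ?thesis using False by blast
  qed
  moreover have "\<phi> \<notin> L" using G0 All_elim unfolding L_def by blast
  ultimately show thesis using that L.temporal_logic_axioms by blast
qed

section \<open>Quasimodels\<close>

definition subformula_closed :: "fml set \<Rightarrow> bool" where
  "subformula_closed Sg \<longleftrightarrow>
    (\<forall>a b. And a b \<in> Sg \<or> Or a b \<in> Sg \<or> Imp a b \<in> Sg \<longrightarrow> a \<in> Sg \<and> b \<in> Sg) \<and>
    (\<forall>a. Next a \<in> Sg \<or> Dia a \<in> Sg \<or> All a \<in> Sg \<longrightarrow> a \<in> Sg)"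

fun subformulas :: "fml \<Rightarrow> fml set" where
  "subformulas Bot = {Bot}"
| "subformulas (Var p) = {Var p}"
| "subformulas (And a b) = insert (And a b) (subformulas a \<union> subformulas b)"
| "subformulas (Or a b) = insert (Or a b) (subformulas a \<union> subformulas b)"
| "subformulas (Imp a b) = insert (Imp a b) (subformulas a \<union> subformulas b)"
| "subformulas (Next a) = insert (Next a) (subformulas a)"
| "subformulas (Dia a) = insert (Dia a) (subformulas a)"
| "subformulas (All a) = insert (All a) (subformulas a)"

lemma finite_subformulas: "finite (subformulas a)"
  by (induction a) auto

lemma subformulas_self: "a \<in> subformulas a"
  by (cases a) auto

lemma subformulas_trans: "a \<in> subformulas b \<Longrightarrow> subformulas a \<subseteq> subformulas b"
  by (induction b) auto

lemma subformula_closed_subformulas: "subformula_closed (subformulas a)"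
  unfolding subformula_closed_def
  by (auto dest!: subformulas_trans simp: subformulas_self subset_iff)

text \<open>\<open>confluent\<close> is the combinatorial form of continuity: worlds above
  \<open>w\<close> have successors above those of \<open>w\<close>. As \<open>S\<close> is
  nondeterministic, \<open>eventuality\<close> promises only some path to fulfilment, whereas
  \<open>lab_Next\<close> and \<open>lab_Dia\<close> bind every successor.\<close>

locale quasimodel =
  fixes I :: "'w set" and le S :: "'w \<Rightarrow> 'w \<Rightarrow> bool" and lab :: "'w \<Rightarrow> fml set" and Sg :: "fml set"
  assumes finite_I: "finite I" and finite_Sg: "finite Sg" and Sg_closed: "subformula_closed Sg"
    and le_I: "le w v \<Longrightarrow> w \<in> I \<and> v \<in> I"
    and S_I: "S w v \<Longrightarrow> w \<in> I \<and> v \<in> I"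
    and le_refl: "w \<in> I \<Longrightarrow> le w w"
    and le_trans: "le u v \<Longrightarrow> le v w \<Longrightarrow> le u w"
    and lab_Sg: "w \<in> I \<Longrightarrow> lab w \<subseteq> Sg"
    and lab_mono: "le w v \<Longrightarrow> lab w \<subseteq> lab v"
    and serial: "w \<in> I \<Longrightarrow> \<exists>v. S w v"
    and confluent: "S w v \<Longrightarrow> le w w' \<Longrightarrow> \<exists>v'. le v v' \<and> S w' v'"
    and lab_Bot: "w \<in> I \<Longrightarrow> Bot \<notin> lab w"
    and lab_And: "w \<in> I \<Longrightarrow> And a b \<in> Sg \<Longrightarrow> And a b \<in> lab w \<longleftrightarrow> a \<in> lab w \<and> b \<in> lab w"
    and lab_Or: "w \<in> I \<Longrightarrow> Or a b \<in> Sg \<Longrightarrow> Or a b \<in> lab w \<longleftrightarrow> a \<in> lab w \<or> b \<in> lab w"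
    and lab_Imp: "w \<in> I \<Longrightarrow> Imp a b \<in> Sg \<Longrightarrow>
      Imp a b \<in> lab w \<longleftrightarrow> (\<forall>v. le w v \<longrightarrow> a \<in> lab v \<longrightarrow> b \<in> lab v)"
    and lab_Next: "S w v \<Longrightarrow> Next a \<in> Sg \<Longrightarrow> Next a \<in> lab w \<longleftrightarrow> a \<in> lab v"
    and lab_Dia: "S w v \<Longrightarrow> Dia a \<in> Sg \<Longrightarrow> Dia a \<in> lab w \<longleftrightarrow> a \<in> lab w \<or> Dia a \<in> lab v"
    and lab_All: "w \<in> I \<Longrightarrow> All a \<in> Sg \<Longrightarrow> All a \<in> lab w \<longleftrightarrow> (\<forall>v\<in>I. a \<in> lab v)"
    and eventuality: "w \<in> I \<Longrightarrow> Dia a \<in> Sg \<Longrightarrow> Dia a \<in> lab w \<Longrightarrow> \<exists>v. S\<^sup>*\<^sup>* w v \<and> a \<in> lab v"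

section \<open>Finite trees of types\<close>

datatype moment = Moment (label: "fml set") (kids: "moment fset")

abbreviation descendant :: "moment \<Rightarrow> moment \<Rightarrow> bool" where
  "descendant \<equiv> (\<lambda>u v. v |\<in>| kids u)\<^sup>*\<^sup>*"

locale finite_fragment = temporal_logic +
  fixes Sg :: "fml set"
  assumes finite_Sg: "finite Sg" and Sg_closed: "subformula_closed Sg"
    and prime_All: "G \<in> prime_thys \<Longrightarrow> All a \<in> G \<longleftrightarrow> a \<in> L"
begin

text \<open>Strict growth of the type bounds the depth of the trees by \<open>card Sg\<close>. An
  extension of the same type gets no node of its own; whatever is above it is already above
  \<open>G\<close>.\<close>

definition above :: "fml set \<Rightarrow> fml set set" where
  "above G = {D \<in> prime_thys. G \<subseteq> D \<and> G \<inter> Sg \<subset> D \<inter> Sg}"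

lemma card_above:
  assumes "D \<in> above G"
  shows "card (Sg - D) < card (Sg - G)"
  using assms unfolding above_def by (intro psubset_card_mono) (auto simp: finite_Sg)

text \<open>\<open>above G\<close> may be infinite and \<open>Abs_fset\<close> says nothing useful
  about infinite sets. Only after \<open>finite_moments\<close> does \<open>kids_moment_of\<close>
  identify the children.\<close>

function moment_of :: "fml set \<Rightarrow> moment" where
  "moment_of G = Moment (G \<inter> Sg) (Abs_fset (moment_of ` above G))"
  by auto
termination
  by (relation "Wellfounded.measure (\<lambda>G. card (Sg - G))") (auto simp: card_above)

declare moment_of.simps [simp del]

definition moments :: "moment set" where
  "moments = moment_of ` prime_thys"

text \<open>Induction on the number of formulas of \<open>Sg\<close> that are missing: a tree at one
  level is a type together with a subset of the finite set of trees of lower levels.\<close>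

lemma finite_moments: "finite moments"
proof -
  have "finite (moment_of ` {G \<in> prime_thys. card (Sg - G) < n})" for n
  proof (induction n)
    case (Suc n)
    let ?A = "moment_of ` {G \<in> prime_thys. card (Sg - G) < n}"
    have "moment_of G \<in> (\<lambda>(t, C). Moment t C) ` (Pow Sg \<times> (fset -` Pow ?A))"
      if "card (Sg - G) < Suc n" for G
    proof -
      have "above G \<subseteq> {G \<in> prime_thys. card (Sg - G) < n}"
        using card_above[of _ G] that unfolding above_def by fastforce
      then have *: "moment_of ` above G \<subseteq> ?A" by blast
      then have "fset (Abs_fset (moment_of ` above G)) \<subseteq> ?A"
        using Suc finite_subset by (metis Abs_fset_inverse mem_Collect_eq)
      then show ?thesis by (subst moment_of.simps) auto
    qed
    then have "moment_of ` {G \<in> prime_thys. card (Sg - G) < Suc n} \<subseteq>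
        (\<lambda>(t, C). Moment t C) ` (Pow Sg \<times> (fset -` Pow ?A))" by blast
    moreover have "finite (fset -` Pow ?A)"
      using Suc by (intro finite_vimageI) (auto simp: inj_def fset_inject)
    ultimately show ?case using finite_Sg by (meson finite_Pow_iff finite_SigmaI finite_imageI finite_subset)
  qed simp
  then have "finite (moment_of ` {G \<in> prime_thys. card (Sg - G) < Suc (card Sg)})" .
  moreover have "card (Sg - G) < Suc (card Sg)" for G
    using card_mono[OF finite_Sg, of "Sg - G"] by auto
  ultimately show ?thesis unfolding moments_def by simp
qed

lemma label_moment_of [simp]: "label (moment_of G) = G \<inter> Sg"
  by (subst moment_of.simps) simp

lemma kids_moment_of: "fset (kids (moment_of G)) = moment_of ` above G"
proof -
  have "moment_of ` above G \<subseteq> moments" unfolding moments_def above_def by blast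
  then show ?thesis
    using finite_moments by (subst moment_of.simps) (simp add: Abs_fset_inverse finite_subset)
qed

text \<open>The matching goes one way: each branch of the tree must be realised above
  \<open>G\<close>, but \<open>G\<close> may have further extensions. This weaker relation, unlike
  equality with \<open>moment_of G\<close>, is easily expressed by a formula.\<close>

inductive simulated :: "moment \<Rightarrow> fml set \<Rightarrow> bool" where
  simulatedI: "G \<in> prime_thys \<Longrightarrow> G \<inter> Sg = t \<Longrightarrow>
    (\<And>c. c |\<in>| C \<Longrightarrow> \<exists>D. G \<subseteq> D \<and> simulated c D) \<Longrightarrow> simulated (Moment t C) G"

lemma simulated_prime: "simulated w G \<Longrightarrow> G \<in> prime_thys"
  by (auto elim: simulated.cases)

lemma simulated_label: "simulated w G \<Longrightarrow> label w = G \<inter> Sg"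
  by (auto elim: simulated.cases)

lemma simulated_Moment:
  "simulated (Moment t C) G \<longleftrightarrow>
    G \<in> prime_thys \<and> G \<inter> Sg = t \<and> (\<forall>c. c |\<in>| C \<longrightarrow> (\<exists>D. G \<subseteq> D \<and> simulated c D))"
  by (subst simulated.simps) auto

lemma simulated_moment_of: "G \<in> prime_thys \<Longrightarrow> simulated (moment_of G) G"
proof (induction "card (Sg - G)" arbitrary: G rule: less_induct)
  case less
  have "simulated (Moment (label (moment_of G)) (kids (moment_of G))) G"
  proof (rule simulatedI)
    fix c assume "c |\<in>| kids (moment_of G)"
    then obtain D where D: "D \<in> above G" "c = moment_of D" using kids_moment_of by blast
    then show "\<exists>D. G \<subseteq> D \<and> simulated c D"
      using less(1)[OF card_above[OF D(1)]] unfolding above_def by blast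
  qed (auto simp: less)
  then show ?case by (simp only: moment.collapse)
qed

text \<open>An analogue of the Jankov-de Jongh formulas.\<close>

lemma simulation_formula:
  "\<exists>c. \<forall>G\<in>prime_thys. c \<notin> G \<longleftrightarrow> (\<exists>D. G \<subseteq> D \<and> simulated w D)"
proof (induction w)
  case (Moment t C)
  then obtain ch where ch: "\<And>c G. c |\<in>| C \<Longrightarrow> G \<in> prime_thys \<Longrightarrow>
      ch c \<notin> G \<longleftrightarrow> (\<exists>D. G \<subseteq> D \<and> simulated c D)" by metis
  show ?case
  proof (cases "t \<subseteq> Sg")
    case True
    obtain c1 where c1: "\<forall>G\<in>prime_thys. c1 \<in> G \<longleftrightarrow> t \<subseteq> G"
      using prime_finite_conj finite_subset[OF True finite_Sg] by blast
    have "finite ((Sg - t) \<union> ch ` fset C)" using finite_Sg by simp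
    \<comment> \<open>\<open>c1\<close> asserts the type \<open>t\<close>; avoiding
      \<open>c2\<close> excludes the rest of \<open>Sg\<close> and, as failure of
      \<open>ch c\<close> means that \<open>c\<close> is simulated above, realises all children.
      \<open>Imp c1 c2\<close> fails exactly below a theory doing both.\<close>
    from prime_finite_disj[OF this] obtain c2 where c2: "\<forall>G\<in>prime_thys. c2 \<in> G \<longleftrightarrow> ((Sg - t) \<union> ch ` fset C) \<inter> G \<noteq> {}"
      by (rule exE)
    have "c1 \<in> D \<and> c2 \<notin> D \<longleftrightarrow> simulated (Moment t C) D" if D: "D \<in> prime_thys" for D
    proof -
      have "c1 \<in> D \<and> c2 \<notin> D \<longleftrightarrow> t \<subseteq> D \<and> (Sg - t) \<inter> D = {} \<and> (\<forall>c. c |\<in>| C \<longrightarrow> ch c \<notin> D)"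
        unfolding bspec[OF c1 D] bspec[OF c2 D] by auto
      also have "\<dots> \<longleftrightarrow> D \<inter> Sg = t \<and> (\<forall>c. c |\<in>| C \<longrightarrow> ch c \<notin> D)"
        using True by auto
      also have "\<dots> \<longleftrightarrow> simulated (Moment t C) D"
        unfolding simulated_Moment using ch D by simp
      finally show ?thesis .
    qed
    then have "\<forall>G\<in>prime_thys. Imp c1 c2 \<notin> G \<longleftrightarrow> (\<exists>D. G \<subseteq> D \<and> simulated (Moment t C) D)"
      using simulated_prime by (simp add: prime_Imp) blast
    then show ?thesis by blast
  next
    case False
    \<comment> \<open>The induction also meets trees with labels outside \<open>Sg\<close>; nothing
      simulates them, so a formula true everywhere serves.\<close>
    then have "\<not> simulated (Moment t C) D" for D using simulated_Moment by auto
    moreover obtain c where "\<forall>G\<in>prime_thys. c \<in> G \<longleftrightarrow> {} \<subseteq> G"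
      using prime_finite_conj[of "{}"] by blast
    ultimately show ?thesis by auto
  qed
qed

section \<open>The successor relation on trees\<close>

definition sensible :: "fml set \<Rightarrow> fml set \<Rightarrow> bool" where
  "sensible t s \<longleftrightarrow> (\<forall>a. Next a \<in> Sg \<longrightarrow> (Next a \<in> t \<longleftrightarrow> a \<in> s)) \<and>
    (\<forall>a. Dia a \<in> Sg \<longrightarrow> (Dia a \<in> t \<longleftrightarrow> a \<in> t \<or> Dia a \<in> s))"

text \<open>Confluence is built in by recursion on the tree: every child of the source must find a
  successor in the subtree rooted at the target.\<close>

inductive succ :: "moment \<Rightarrow> moment \<Rightarrow> bool" where
  succI: "sensible t (label v) \<Longrightarrow> (\<And>c. c |\<in>| C \<Longrightarrow> \<exists>v'. descendant v v' \<and> succ c v') \<Longrightarrow>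
    succ (Moment t C) v"

lemma sensible_next:
  assumes G: "G \<in> prime_thys"
  shows "sensible (G \<inter> Sg) (next_thy G \<inter> Sg)"
  unfolding sensible_def
proof (intro conjI allI impI)
  fix a assume a: "Next a \<in> Sg"
  then have "a \<in> Sg" using Sg_closed unfolding subformula_closed_def by blast
  then show "Next a \<in> G \<inter> Sg \<longleftrightarrow> a \<in> next_thy G \<inter> Sg" using a by (simp add: in_next_thy)
next
  fix a assume a: "Dia a \<in> Sg"
  then have "a \<in> Sg" using Sg_closed unfolding subformula_closed_def by blast
  then show "Dia a \<in> G \<inter> Sg \<longleftrightarrow> a \<in> G \<inter> Sg \<or> Dia a \<in> next_thy G \<inter> Sg"
    using a prime_Dia[OF G, of a] by simp
qed

text \<open>Needed when two theories share a type: the tree of the larger one has the same label and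
  fewer children, yet does not occur as a node below the smaller one.\<close>

lemma succ_weaken:
  "succ w u \<Longrightarrow> label u = label v \<Longrightarrow> fset (kids u) \<subseteq> fset (kids v) \<Longrightarrow> succ w v"
proof (induction arbitrary: v rule: succ.induct)
  case (succI t u C)
  show ?case
  proof (rule succ.succI)
    show "sensible t (label v)" using succI by simp
    fix c assume "c |\<in>| C"
    then obtain u' where u': "descendant u u'" "succ c u'"
      "\<And>v. label u' = label v \<Longrightarrow> fset (kids u') \<subseteq> fset (kids v) \<Longrightarrow> succ c v"
      using succI(2) by blast
    from u'(1) show "\<exists>v'. descendant v v' \<and> succ c v'"
    proof (cases rule: converse_rtranclpE)
      case base
      then show ?thesis using u'(3)[of v] succI by blast
    next
      case (step k)
      then have "descendant v u'" using succI(4) by (meson converse_rtranclp_into_rtranclp subsetD)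
      then show ?thesis using u'(2) by blast
    qed
  qed
qed

text \<open>\<open>w\<close> need not be the tree of \<open>G\<close>; being simulated already fixes
  enough of it. This generality is what the invariant for eventualities uses.\<close>

lemma simulated_succ: "simulated w G \<Longrightarrow> succ w (moment_of (next_thy G))"
proof (induction rule: simulated.induct)
  case (simulatedI G t C)
  let ?v = "moment_of (next_thy G)"
  show ?case
  proof (rule succ.succI)
    show "sensible t (label ?v)" using sensible_next simulatedI(1,2) by auto
    fix c assume "c |\<in>| C"
    then obtain D where D: "G \<subseteq> D" "simulated c D" "succ c (moment_of (next_thy D))"
      using simulatedI(3) by blast
    have mono: "next_thy G \<subseteq> next_thy D" using D(1) next_thy_mono by blast
    show "\<exists>v'. descendant ?v v' \<and> succ c v'"
    \<comment> \<open>Different types may acquire equal successor types. Then the tree of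
      \<open>next_thy D\<close> is no child of \<open>?v\<close>, but \<open>?v\<close> itself can
      replace it.\<close>
    proof (cases "next_thy D \<inter> Sg = next_thy G \<inter> Sg")
      case True
      then have "above (next_thy D) \<subseteq> above (next_thy G)" using mono unfolding above_def by auto
      then have "succ c ?v" by (intro succ_weaken[OF D(3)]) (auto simp: True kids_moment_of)
      then show ?thesis by blast
    next
      case False
      then have "next_thy D \<in> above (next_thy G)"
        using mono prime_next[OF simulated_prime[OF D(2)]] unfolding above_def by auto
      then have "moment_of (next_thy D) |\<in>| kids ?v" using kids_moment_of by blast
      then show ?thesis using D(3) by blast
    qed
  qed
qed

lemma succ_sensible: "succ w v \<Longrightarrow> sensible (label w) (label v)"
  by (auto elim: succ.cases)

lemma succ_kids: "succ u v \<Longrightarrow> c |\<in>| kids u \<Longrightarrow> \<exists>v'. descendant v v' \<and> succ c v'"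
  by (erule succ.cases) simp

lemma succ_confluent: "descendant w w' \<Longrightarrow> succ w v \<Longrightarrow> \<exists>v'. descendant v v' \<and> succ w' v'"
proof (induction rule: rtranclp_induct)
  case (step u c)
  then obtain v' where v': "descendant v v'" "succ u v'" by blast
  then obtain v'' where "descendant v' v''" "succ c v''"
    using succ_kids step(2) by blast
  then show ?case using v'(1) by (meson rtranclp_trans)
qed blast

lemma descendant_moment_of:
  "descendant (moment_of G) v \<Longrightarrow> G \<in> prime_thys \<Longrightarrow>
    \<exists>D\<in>prime_thys. G \<subseteq> D \<and> v = moment_of D"
proof (induction rule: rtranclp_induct)
  case (step u v)
  then obtain D where D: "D \<in> prime_thys" "G \<subseteq> D" "u = moment_of D" by blast
  then obtain D' where "D' \<in> above D" "v = moment_of D'" using step(2) kids_moment_of by blast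
  then show ?case using D unfolding above_def by blast
qed blast

section \<open>The quasimodel of moments\<close>

definition mle :: "moment \<Rightarrow> moment \<Rightarrow> bool" where
  "mle u v \<longleftrightarrow> u \<in> moments \<and> v \<in> moments \<and> descendant u v"

definition msucc :: "moment \<Rightarrow> moment \<Rightarrow> bool" where
  "msucc u v \<longleftrightarrow> u \<in> moments \<and> v \<in> moments \<and> succ u v"

lemma moments_descendant: "u \<in> moments \<Longrightarrow> descendant u v \<Longrightarrow> v \<in> moments"
  using descendant_moment_of unfolding moments_def by blast

text \<open>If no moment reachable from \<open>w\<close> contained \<open>a\<close>, the conjunction of the simulation formulas
  of these moments would be an invariant implied by \<open>a\<close>, hence implied by \<open>Dia a\<close>,
  although it fails at \<open>w\<close>.\<close>

lemma moment_eventuality: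
  assumes w: "w \<in> moments" and a: "Dia a \<in> label w" "a \<in> Sg"
  shows "\<exists>v. msucc\<^sup>*\<^sup>* w v \<and> a \<in> label v"
proof (rule ccontr)
  assume neg: "\<not> ?thesis"
  obtain ch where ch: "\<And>w G. G \<in> prime_thys \<Longrightarrow> ch w \<notin> G \<longleftrightarrow> (\<exists>D. G \<subseteq> D \<and> simulated w D)"
    using simulation_formula by metis
  define R where "R = {v \<in> moments. msucc\<^sup>*\<^sup>* w v}"
  have "finite (ch ` R)" using finite_moments unfolding R_def by simp
  from prime_finite_conj[OF this]
  obtain c where c: "\<forall>G\<in>prime_thys. c \<in> G \<longleftrightarrow> ch ` R \<subseteq> G" by (rule exE)
  \<comment> \<open>Contrapositive: a failure of \<open>c\<close> at \<open>G\<close> yields some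
    \<open>v\<close> in \<open>R\<close> simulated by an extension \<open>D\<close>. The tree of
    \<open>next_thy D\<close> is a successor of \<open>v\<close>, hence in \<open>R\<close>, and
    simulates itself, so \<open>c\<close> fails one step later.\<close>
  have inv: "c \<in> G" if G: "G \<in> prime_thys" "c \<in> next_thy G" for G
  proof (rule ccontr)
    assume "c \<notin> G"
    then obtain v where v: "v \<in> R" "ch v \<notin> G" using c G(1) by blast
    then obtain D where D: "G \<subseteq> D" "simulated v D" using ch[OF G(1)] by blast
    let ?u = "moment_of (next_thy D)"
    have nxt: "next_thy D \<in> prime_thys" using simulated_prime[OF D(2)] prime_next by blast
    then have "?u \<in> moments" unfolding moments_def by blast
    then have "msucc v ?u" using simulated_succ[OF D(2)] v(1) unfolding msucc_def R_def by blast
    then have "?u \<in> R" using v(1) \<open>?u \<in> moments\<close> unfolding R_def by auto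
    moreover have "ch ?u \<notin> next_thy D" using ch[OF nxt] simulated_moment_of[OF nxt] by blast
    moreover have "c \<in> next_thy D" using G(2) next_thy_mono[OF D(1)] by blast
    ultimately show False using c nxt by blast
  qed
  have start: "c \<in> G" if G: "G \<in> prime_thys" "a \<in> G" for G
  proof (rule ccontr)
    assume "c \<notin> G"
    then obtain v where v: "v \<in> R" "ch v \<notin> G" using c G(1) by blast
    then obtain D where "G \<subseteq> D" "simulated v D" using ch[OF G(1)] by blast
    then have "a \<in> label v" using simulated_label G(2) a(2) by blast
    then show False using neg v(1) unfolding R_def by blast
  qed
  obtain G where G: "G \<in> prime_thys" "w = moment_of G" using w unfolding moments_def by blast
  then have "Dia a \<in> G" using a(1) by simp
  then have "Dia c \<in> G" using prime_Dia_mono[OF start] G(1) by blast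
  then have "c \<in> G" using prime_Dia_ind[OF inv] G(1) by blast
  moreover have "w \<in> R" using w unfolding R_def by simp
  ultimately have "ch w \<in> G" using c G(1) by blast
  then show False using ch[OF G(1)] simulated_moment_of G by blast
qed

lemma quasimodel_moments: "quasimodel moments mle msucc label Sg"
proof
  show "finite moments" by (rule finite_moments)
  show "finite Sg" by (rule finite_Sg)
  show "subformula_closed Sg" by (rule Sg_closed)
  show "w \<in> moments \<and> v \<in> moments" if "mle w v" for w v using that unfolding mle_def by blast
  show "w \<in> moments \<and> v \<in> moments" if "msucc w v" for w v using that unfolding msucc_def by blast
  show "mle w w" if "w \<in> moments" for w using that unfolding mle_def by blast
  show "mle u w" if "mle u v" "mle v w" for u v w using that unfolding mle_def by auto
  show "label w \<subseteq> Sg" if "w \<in> moments" for w using that unfolding moments_def by auto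
  show "label w \<subseteq> label v" if "mle w v" for w v
    using that descendant_moment_of unfolding mle_def moments_def by fastforce
  show "\<exists>v. msucc w v" if "w \<in> moments" for w
  proof -
    obtain G where G: "G \<in> prime_thys" "w = moment_of G" using \<open>w \<in> moments\<close> unfolding moments_def by blast
    then have "msucc w (moment_of (next_thy G))"
      using simulated_succ[OF simulated_moment_of] prime_next unfolding msucc_def moments_def by blast
    then show ?thesis by blast
  qed
  show "\<exists>v'. mle v v' \<and> msucc w' v'" if "msucc w v" "mle w w'" for w v w'
    using that succ_confluent[of w w' v] moments_descendant unfolding mle_def msucc_def by blast
  show "Bot \<notin> label w" if "w \<in> moments" for w using that prime_Bot unfolding moments_def by auto
  show "And a b \<in> label w \<longleftrightarrow> a \<in> label w \<and> b \<in> label w"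
    if "w \<in> moments" "And a b \<in> Sg" for w a b
  proof -
    have "a \<in> Sg" "b \<in> Sg" using that(2) Sg_closed unfolding subformula_closed_def by blast+
    then show ?thesis using that unfolding moments_def by (auto simp: prime_And)
  qed
  show "Or a b \<in> label w \<longleftrightarrow> a \<in> label w \<or> b \<in> label w"
    if "w \<in> moments" "Or a b \<in> Sg" for w a b
  proof -
    have "a \<in> Sg" "b \<in> Sg" using that(2) Sg_closed unfolding subformula_closed_def by blast+
    then show ?thesis using that unfolding moments_def by (auto simp: prime_Or)
  qed
  show "Imp a b \<in> label w \<longleftrightarrow> (\<forall>v. mle w v \<longrightarrow> a \<in> label v \<longrightarrow> b \<in> label v)"
    if w: "w \<in> moments" and ab: "Imp a b \<in> Sg" for w a b
  proof -
    obtain G where G: "G \<in> prime_thys" "w = moment_of G" using w unfolding moments_def by blast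
    have sub: "a \<in> Sg" "b \<in> Sg" using ab Sg_closed unfolding subformula_closed_def by blast+
    have "b \<in> label v" if imp: "Imp a b \<in> label w" and v: "mle w v" "a \<in> label v" for v
    proof -
      obtain D where D: "D \<in> prime_thys" "G \<subseteq> D" "v = moment_of D"
        using descendant_moment_of v(1) G unfolding mle_def by blast
      then have "b \<in> D" using prime_mp[OF D(1), of a b] imp v(2) G(2) by auto
      then show ?thesis using D(3) sub by simp
    qed
    moreover have "Imp a b \<in> label w"
      if R: "\<forall>v. mle w v \<longrightarrow> a \<in> label v \<longrightarrow> b \<in> label v"
    proof (rule ccontr)
      assume "Imp a b \<notin> label w"
      then have "Imp a b \<notin> G" using G(2) ab by simp
      then obtain D where D: "D \<in> prime_thys" "G \<subseteq> D" "a \<in> D" "b \<notin> D"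
        using prime_Imp[OF G(1)] by auto
      \<comment> \<open>The refuting theory may have the type of \<open>G\<close> and thus no node
        of its own; then \<open>w\<close> is the counterexample.\<close>
      have "\<exists>v. mle w v \<and> label v = D \<inter> Sg"
      proof (cases "D \<inter> Sg = G \<inter> Sg")
        case True
        then show ?thesis using w G(2) unfolding mle_def by auto
      next
        case False
        then have "D \<in> above G" using D unfolding above_def by auto
        then have "moment_of D |\<in>| kids w" using kids_moment_of G(2) by blast
        then have "mle w (moment_of D)" using w moments_descendant unfolding mle_def by blast
        then show ?thesis by auto
      qed
      then show False using R D sub by auto
    qed
    ultimately show ?thesis by blast
  qed
  show "Next a \<in> label w \<longleftrightarrow> a \<in> label v" if "msucc w v" "Next a \<in> Sg" for w v a
    using that succ_sensible unfolding msucc_def sensible_def by blast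
  show "Dia a \<in> label w \<longleftrightarrow> a \<in> label w \<or> Dia a \<in> label v" if "msucc w v" "Dia a \<in> Sg" for w v a
    using that succ_sensible unfolding msucc_def sensible_def by blast
  show "All a \<in> label w \<longleftrightarrow> (\<forall>v\<in>moments. a \<in> label v)" if w: "w \<in> moments" and a: "All a \<in> Sg" for w a
  proof -
    have "a \<in> Sg" using a Sg_closed unfolding subformula_closed_def by blast
    then have "(\<forall>v\<in>moments. a \<in> label v) \<longleftrightarrow> a \<in> L" unfolding moments_def in_L_iff by simp
    then show ?thesis using w a prime_All unfolding moments_def by auto
  qed
  show "\<exists>v. msucc\<^sup>*\<^sup>* w v \<and> a \<in> label v" if "w \<in> moments" "Dia a \<in> Sg" "Dia a \<in> label w" for w a
    using moment_eventuality[OF that(1,3)] that(2) Sg_closed unfolding subformula_closed_def by blast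
qed

lemma moment_refutes:
  assumes "a \<notin> L"
  shows "\<exists>w\<in>moments. a \<notin> label w"
  using assms unfolding moments_def in_L_iff by auto

end

lemma quasimodel_completeness:
  assumes "\<phi> \<notin> ITL0"
  obtains I :: "moment set" and le S lab w
  where "quasimodel I le S lab (subformulas \<phi>)" "w \<in> I" "\<phi> \<notin> lab w"
proof -
  obtain L where "temporal_logic L" and L: "\<phi> \<notin> L"
    "\<And>a G. G \<in> temporal_logic.prime_thys L \<Longrightarrow> All a \<in> G \<longleftrightarrow> a \<in> L"
    using universal_logic[OF assms] by metis
  then interpret finite_fragment L "subformulas \<phi>"
    unfolding finite_fragment_def finite_fragment_axioms_def
    using finite_subformulas subformula_closed_subformulas by blast
  show thesis using that quasimodel_moments moment_refutes[OF L(1)] by blast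
qed

section \<open>Countable dense orders and spaces of sequences\<close>

text \<open>Carrier and relation are explicit because one of the two orders lives on a set of
  sequences and depends on a chosen enumeration.\<close>

locale countable_dense_order =
  fixes A :: "'a set" and less :: "'a \<Rightarrow> 'a \<Rightarrow> bool" (infix "\<sqsubset>" 50)
  assumes countable: "countable A" and nonempty: "A \<noteq> {}"
    and irrefl: "x \<in> A \<Longrightarrow> \<not> x \<sqsubset> x"
    and trans: "x \<in> A \<Longrightarrow> y \<in> A \<Longrightarrow> z \<in> A \<Longrightarrow> x \<sqsubset> y \<Longrightarrow> y \<sqsubset> z \<Longrightarrow> x \<sqsubset> z"
    and total: "x \<in> A \<Longrightarrow> y \<in> A \<Longrightarrow> x \<noteq> y \<Longrightarrow> x \<sqsubset> y \<or> y \<sqsubset> x"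
    and dense: "x \<in> A \<Longrightarrow> y \<in> A \<Longrightarrow> x \<sqsubset> y \<Longrightarrow> \<exists>z\<in>A. x \<sqsubset> z \<and> z \<sqsubset> y"
    and no_min: "x \<in> A \<Longrightarrow> \<exists>y\<in>A. y \<sqsubset> x"
    and no_max: "x \<in> A \<Longrightarrow> \<exists>y\<in>A. x \<sqsubset> y"
begin

lemma finite_has_max:
  assumes "finite F" "F \<noteq> {}" "F \<subseteq> A"
  shows "\<exists>m\<in>F. \<forall>x\<in>F. x = m \<or> x \<sqsubset> m"
  using assms
proof (induction rule: finite_ne_induct)
  case (insert x F)
  then obtain m where m: "m \<in> F" "\<forall>y\<in>F. y = m \<or> y \<sqsubset> m" by auto
  then have "m \<in> A" "x \<in> A" "\<forall>y\<in>F. y \<in> A" using insert by auto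
  then show ?case using m total trans by (cases "m \<sqsubset> x") (metis insert_iff)+
qed simp

lemma finite_has_min:
  assumes "finite F" "F \<noteq> {}" "F \<subseteq> A"
  shows "\<exists>m\<in>F. \<forall>x\<in>F. x = m \<or> m \<sqsubset> x"
  using assms
proof (induction rule: finite_ne_induct)
  case (insert x F)
  then obtain m where m: "m \<in> F" "\<forall>y\<in>F. y = m \<or> m \<sqsubset> y" by auto
  then have "m \<in> A" "x \<in> A" "\<forall>y\<in>F. y \<in> A" using insert by auto
  then show ?case using m total trans by (cases "x \<sqsubset> m") (metis insert_iff)+
qed simp

text \<open>Empty \<open>L\<close> or \<open>H\<close> is allowed, so density and the absence of end
  points are packed into the one property that back-and-forth consumes.\<close>

lemma between_finite:
  assumes L: "finite L" "L \<subseteq> A" and H: "finite H" "H \<subseteq> A"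
    and LH: "\<And>l h. l \<in> L \<Longrightarrow> h \<in> H \<Longrightarrow> l \<sqsubset> h"
  shows "\<exists>y\<in>A. (\<forall>l\<in>L. l \<sqsubset> y) \<and> (\<forall>h\<in>H. y \<sqsubset> h)"
proof -
  have below: "\<forall>h\<in>H. y \<sqsubset> h" if "y \<in> A" "m \<in> H" "y \<sqsubset> m" "\<forall>x\<in>H. x = m \<or> m \<sqsubset> x" for y m
  proof
    fix h assume "h \<in> H"
    then show "y \<sqsubset> h" using trans[of y m h] that H(2) by (cases "h = m") auto
  qed
  have above: "\<forall>l\<in>L. l \<sqsubset> y" if "y \<in> A" "m \<in> L" "m \<sqsubset> y" "\<forall>x\<in>L. x = m \<or> x \<sqsubset> m" for y m
  proof
    fix l assume "l \<in> L"
    then show "l \<sqsubset> y" using trans[of l m y] that L(2) by (cases "l = m") auto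
  qed
  consider "L = {}" "H = {}" | "L \<noteq> {}" "H = {}" | "L = {}" "H \<noteq> {}" | "L \<noteq> {}" "H \<noteq> {}" by blast
  then show ?thesis
  proof cases
    case 1
    then show ?thesis using nonempty by blast
  next
    case 2
    from finite_has_max[OF L(1) 2(1) L(2)]
    obtain m where m: "m \<in> L" "\<forall>x\<in>L. x = m \<or> x \<sqsubset> m" by (rule bexE)
    then obtain y where y: "y \<in> A" "m \<sqsubset> y" using no_max[of m] L(2) by auto
    show ?thesis using above[OF y(1) m(1) y(2) m(2)] y(1) 2(2) by auto
  next
    case 3
    from finite_has_min[OF H(1) 3(2) H(2)]
    obtain m where m: "m \<in> H" "\<forall>x\<in>H. x = m \<or> m \<sqsubset> x" by (rule bexE)
    then obtain y where y: "y \<in> A" "y \<sqsubset> m" using no_min[of m] H(2) by auto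
    show ?thesis using below[OF y(1) m(1) y(2) m(2)] y(1) 3(1) by auto
  next
    case 4
    from finite_has_max[OF L(1) 4(1) L(2)]
    obtain m where m: "m \<in> L" "\<forall>x\<in>L. x = m \<or> x \<sqsubset> m" by (rule bexE)
    from finite_has_min[OF H(1) 4(2) H(2)]
    obtain n where n: "n \<in> H" "\<forall>x\<in>H. x = n \<or> n \<sqsubset> x" by (rule bexE)
    have mn: "m \<in> A" "n \<in> A" "m \<sqsubset> n" using m(1) n(1) L(2) H(2) LH by auto
    obtain y where y: "y \<in> A" "m \<sqsubset> y" "y \<sqsubset> n" using dense[OF mn] by blast
    then show ?thesis using above[OF y(1) m(1) y(2) m(2)] below[OF y(1) n(1) y(3) n(2)] by blast
  qed
qed

end

text \<open>For irreflexive total orders this forces the relation to be single-valued and injective.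
  Using a relation rather than a function makes the notion symmetric, so the back step is the forth
  step for the converse.\<close>

definition partial_iso :: "('a \<Rightarrow> 'a \<Rightarrow> bool) \<Rightarrow> ('b \<Rightarrow> 'b \<Rightarrow> bool) \<Rightarrow> ('a \<times> 'b) set \<Rightarrow> bool" where
  "partial_iso r s G \<longleftrightarrow> (\<forall>x y x' y'. (x, y) \<in> G \<longrightarrow> (x', y') \<in> G \<longrightarrow> r x x' = s y y')"

lemma partial_iso_converse: "partial_iso s r (G\<inverse>) \<longleftrightarrow> partial_iso r s G"
  unfolding partial_iso_def by auto

lemma partial_iso_extend:
  assumes A: "countable_dense_order A r" and B: "countable_dense_order B s"
    and G: "finite G" "G \<subseteq> A \<times> B" "partial_iso r s G" and x: "x \<in> A"
  shows "\<exists>y\<in>B. partial_iso r s (insert (x, y) G)"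
proof (cases "\<exists>y. (x, y) \<in> G")
  case True
  then obtain y where "(x, y) \<in> G" by blast
  then have "y \<in> B" "insert (x, y) G = G" using G by auto
  then show ?thesis using G(3) by metis
next
  case False
  interpret A: countable_dense_order A r by fact
  interpret B: countable_dense_order B s by fact
  let ?L = "{b. \<exists>a. (a, b) \<in> G \<and> r a x}" and ?H = "{b. \<exists>a. (a, b) \<in> G \<and> r x a}"
  have "\<exists>y\<in>B. (\<forall>l\<in>?L. s l y) \<and> (\<forall>h\<in>?H. s y h)"
  proof (rule B.between_finite)
    show "s l h" if lh: "l \<in> ?L" "h \<in> ?H" for l h
    proof -
      obtain a b where ab: "(a, l) \<in> G" "r a x" "(b, h) \<in> G" "r x b" using lh by auto
      then have "r a b" using A.trans[of a x b] G(2) x by blast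
      then show ?thesis using ab G(3) unfolding partial_iso_def by blast
    qed
    show "finite ?L" "finite ?H" by (rule finite_subset[OF _ finite_imageI[OF G(1), of snd]]; force)+
    show "?L \<subseteq> B" "?H \<subseteq> B" using G(2) by auto
  qed
  then obtain y where yB: "y \<in> B" and yL: "\<forall>l\<in>?L. s l y" and yH: "\<forall>h\<in>?H. s y h" by blast
  have y: "y \<in> B" "\<And>a b. (a, b) \<in> G \<Longrightarrow> r a x \<Longrightarrow> s b y" "\<And>a b. (a, b) \<in> G \<Longrightarrow> r x a \<Longrightarrow> s y b"
    using yB yL yH by auto
  have "r x a = s y b \<and> r a x = s b y" if ab: "(a, b) \<in> G" for a b
  proof -
    have m: "a \<in> A" "b \<in> B" "a \<noteq> x" using ab G(2) False by auto
    consider "r a x" | "r x a" using A.total[OF m(1) x m(3)] by blast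
    then show ?thesis
    proof cases
      case 1
      then show ?thesis using y(2)[OF ab] m x y(1) A.trans A.irrefl B.trans B.irrefl by metis
    next
      case 2
      then show ?thesis using y(3)[OF ab] m x y(1) A.trans A.irrefl B.trans B.irrefl by metis
    qed
  qed
  moreover have "\<not> r x x" "\<not> s y y" using A.irrefl B.irrefl x y(1) by auto
  ultimately have "partial_iso r s (insert (x, y) G)"
    using G(3) unfolding partial_iso_def by auto
  then show ?thesis using y(1) by blast
qed

theorem cantor_isomorphism:
  assumes A: "countable_dense_order A r" and B: "countable_dense_order B s"
  obtains h where "bij_betw h A B" "\<And>x y. x \<in> A \<Longrightarrow> y \<in> A \<Longrightarrow> r x y \<longleftrightarrow> s (h x) (h y)"
proof -
  interpret A: countable_dense_order A r by fact
  interpret B: countable_dense_order B s by fact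
  let ?a = "from_nat_into A" and ?b = "from_nat_into B"
  have a: "range ?a = A" and b: "range ?b = B"
    using A.countable A.nonempty B.countable B.nonempty by (auto intro: range_from_nat_into)
  let ?P = "\<lambda>n G. finite G \<and> G \<subseteq> A \<times> B \<and> partial_iso r s G"
  let ?Q = "\<lambda>n G G'. G \<subseteq> G' \<and> ?a n \<in> fst ` G' \<and> ?b n \<in> snd ` G'"
  have "\<exists>F. \<forall>n. ?P n (F n) \<and> ?Q n (F n) (F (Suc n))"
  proof (rule dependent_nat_choice)
    show "\<exists>G. ?P 0 G" by (rule exI[of _ "{}"]) (simp add: partial_iso_def)
    fix G n assume G: "?P n G"
    have an: "?a n \<in> A" and bn: "?b n \<in> B" using a b by auto
    obtain y where y: "y \<in> B" "partial_iso r s (insert (?a n, y) G)"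
      using partial_iso_extend[OF A B _ _ _ an] G by blast
    let ?G = "insert (?a n, y) G"
    have "finite (?G\<inverse>)" "?G\<inverse> \<subseteq> B \<times> A" "partial_iso s r (?G\<inverse>)"
      using G y an by (auto simp: partial_iso_converse)
    then obtain x where x: "x \<in> A" "partial_iso s r (insert (?b n, x) (?G\<inverse>))"
      using partial_iso_extend[OF B A _ _ _ bn] by blast
    have "insert (?b n, x) (?G\<inverse>) = (insert (x, ?b n) ?G)\<inverse>" by auto
    then have "partial_iso r s (insert (x, ?b n) ?G)" using x(2) by (metis partial_iso_converse)
    then have "?P (Suc n) (insert (x, ?b n) ?G) \<and> ?Q n G (insert (x, ?b n) ?G)"
      using G an bn x(1) y(1) by auto
    then show "\<exists>G'. ?P (Suc n) G' \<and> ?Q n G G'" by (rule exI)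
  qed
  then obtain F where F: "\<And>n. ?P n (F n)" "\<And>n. ?Q n (F n) (F (Suc n))" by auto
  have mono: "F m \<subseteq> F n" if "m \<le> n" for m n
    using lift_Suc_mono_le[of F, OF _ that] F(2) by blast
  define U where "U = (\<Union>n. F n)"
  have U_iso: "r x x' = s y y'" if U: "(x, y) \<in> U" "(x', y') \<in> U" for x y x' y'
  proof -
    obtain m n where "(x, y) \<in> F m" "(x', y') \<in> F n" using U unfolding U_def by blast
    then have "(x, y) \<in> F (max m n)" "(x', y') \<in> F (max m n)"
      using mono[of m "max m n"] mono[of n "max m n"] by auto
    then show ?thesis using F(1)[of "max m n"] unfolding partial_iso_def by blast
  qed
  have U_sub: "x \<in> A \<and> y \<in> B" if "(x, y) \<in> U" for x y
    using that F(1) unfolding U_def by blast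
  have U_dom: "\<exists>y. (x, y) \<in> U" if x: "x \<in> A" for x
  proof -
    obtain n where "x = ?a n" using a x by blast
    then have "x \<in> fst ` F (Suc n)" using F(2) by blast
    then show ?thesis unfolding U_def by force
  qed
  have U_ran: "\<exists>x. (x, y) \<in> U" if y: "y \<in> B" for y
  proof -
    obtain n where "y = ?b n" using b y by blast
    then have "y \<in> snd ` F (Suc n)" using F(2) by blast
    then show ?thesis unfolding U_def by force
  qed
  have U_eq: "x = x' \<longleftrightarrow> y = y'" if U: "(x, y) \<in> U" "(x', y') \<in> U" for x y x' y'
    using U_iso[OF U] U_iso[OF U(2,1)] U_iso[OF U(1,1)] U_sub[OF U(1)] U_sub[OF U(2)]
      A.irrefl A.total B.irrefl B.total by metis
  obtain h where h: "\<And>x. x \<in> A \<Longrightarrow> (x, h x) \<in> U" using U_dom by metis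
  show thesis
  proof (rule that)
    show "r x y \<longleftrightarrow> s (h x) (h y)" if "x \<in> A" "y \<in> A" for x y using U_iso h that by blast
    have "inj_on h A" using U_eq h unfolding inj_on_def by blast
    moreover have "h ` A = B"
    proof
      show "h ` A \<subseteq> B" using h U_sub by blast
      show "B \<subseteq> h ` A"
      proof
        fix y assume "y \<in> B"
        then obtain x where x: "(x, y) \<in> U" using U_ran by blast
        then have "x \<in> A" using U_sub by blast
        then have "h x = y" using U_eq[OF h x] by blast
        then show "y \<in> h ` A" using \<open>x \<in> A\<close> by blast
      qed
    qed
    ultimately show "bij_betw h A B" unfolding bij_betw_def by blast
  qed
qed

lemma countable_dense_order_Rats: "countable_dense_order (\<rat> :: real set) (<)"
proof
  show "countable (\<rat> :: real set)" by (rule countable_rat)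
  show "\<exists>z\<in>\<rat>. x < z \<and> z < y" if "x < y" for x y :: real using Rats_dense_in_real[OF that] by blast
  show "\<exists>y\<in>\<rat>. y < x" if "x \<in> \<rat>" for x :: real using that by (intro bexI[of _ "x - 1"]) auto
  show "\<exists>y\<in>\<rat>. x < y" if "x \<in> \<rat>" for x :: real using that by (intro bexI[of _ "x + 1"]) auto
qed (auto intro: Rats_0)

section \<open>Lexicographic orders on infinitely branching sequences\<close>

definition agree :: "nat \<Rightarrow> (nat \<Rightarrow> 'a) \<Rightarrow> (nat \<Rightarrow> 'a) \<Rightarrow> bool" where
  "agree n x y \<longleftrightarrow> (\<forall>i<n. x i = y i)"

lemma agree_refl [simp]: "agree n x x"
  unfolding agree_def by simp

lemma agree_sym: "agree n x y \<Longrightarrow> agree n y x"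
  unfolding agree_def by simp

lemma agree_trans: "agree n x y \<Longrightarrow> agree n y z \<Longrightarrow> agree n x z"
  unfolding agree_def by simp

lemma agree_le: "agree n x y \<Longrightarrow> m \<le> n \<Longrightarrow> agree m x y"
  unfolding agree_def by simp

locale branching_sequences =
  fixes X :: "(nat \<Rightarrow> 'a) set"
  assumes countable: "countable X" and nonempty: "X \<noteq> {}"
    and branching: "x \<in> X \<Longrightarrow> infinite {y n |y. y \<in> X \<and> agree n x y}"
begin

definition branches :: "(nat \<Rightarrow> 'a) \<Rightarrow> nat \<Rightarrow> 'a set" where
  "branches x n = {y n |y. y \<in> X \<and> agree n x y}"

text \<open>The children of each node are numbered by all integers, an order without end points. So
  every child has siblings on both sides, which makes cylinders open in the lexicographic
  order.\<close>

definition code :: "(nat \<Rightarrow> 'a) \<Rightarrow> nat \<Rightarrow> int" where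
  "code x n = int_decode (to_nat_on (branches x n) (x n))"

lemma branches_cong: "agree n x y \<Longrightarrow> branches x n = branches y n"
  unfolding branches_def agree_def by auto

lemma bij_branches:
  assumes "x \<in> X"
  shows "bij_betw (\<lambda>a. int_decode (to_nat_on (branches x n) a)) (branches x n) UNIV"
proof -
  have "branches x n \<subseteq> (\<lambda>y. y n) ` X" unfolding branches_def by auto
  then have "countable (branches x n)" using countable countable_subset by blast
  then have "bij_betw (to_nat_on (branches x n)) (branches x n) UNIV"
    using branching[OF assms] to_nat_on_infinite unfolding branches_def by blast
  from bij_betw_trans[OF this bij_int_decode] show ?thesis by (simp add: comp_def)
qed

lemma code_eq_iff:
  assumes "x \<in> X" "y \<in> X" "agree n x y"
  shows "code x n = code y n \<longleftrightarrow> x n = y n"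
proof -
  have "x n \<in> branches x n" "y n \<in> branches x n"
    using assms unfolding branches_def by auto
  then show ?thesis
    using bij_betw_imp_inj_on[OF bij_branches[OF assms(1), of n]] branches_cong[OF assms(3)]
    unfolding code_def by (metis (no_types, lifting) inj_on_def)
qed

lemma code_exists:
  assumes "x \<in> X"
  shows "\<exists>y\<in>X. agree n x y \<and> code y n = k"
proof -
  have "k \<in> (\<lambda>a. int_decode (to_nat_on (branches x n) a)) ` branches x n"
    using bij_betw_imp_surj_on[OF bij_branches[OF assms, of n]] by simp
  then obtain a where a: "a \<in> branches x n" "int_decode (to_nat_on (branches x n) a) = k" by auto
  then obtain y where y: "y \<in> X" "agree n x y" "y n = a" unfolding branches_def by auto
  then have "code y n = k" using a(2) unfolding code_def branches_cong[OF y(2)] by simp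
  then show ?thesis using y by blast
qed

lemma code_cong: "x \<in> X \<Longrightarrow> y \<in> X \<Longrightarrow> agree n x y \<Longrightarrow> i < n \<Longrightarrow> code x i = code y i"
  using code_eq_iff[of x y i] agree_le[of n x y i] unfolding agree_def by simp

definition lex :: "(nat \<Rightarrow> 'a) \<Rightarrow> (nat \<Rightarrow> 'a) \<Rightarrow> bool" where
  "lex x y \<longleftrightarrow> (\<exists>n. agree n x y \<and> code x n < code y n)"

lemma countable_dense_order_lex: "countable_dense_order X lex"
proof
  show "countable X" "X \<noteq> {}" by (rule countable nonempty)+
  show "\<not> lex x x" for x unfolding lex_def by simp
  show "lex x z" if X: "x \<in> X" "y \<in> X" "z \<in> X" and lt: "lex x y" "lex y z" for x y z
  proof -
    obtain m n where mn: "agree m x y" "code x m < code y m" "agree n y z" "code y n < code z n"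
      using lt unfolding lex_def by blast
    have ag: "agree (min m n) x z" using mn agree_le agree_trans by (metis min.cobounded1 min.cobounded2)
    consider "m < n" | "m = n" | "n < m" by linarith
    then have "code x (min m n) < code z (min m n)"
    proof cases
      case 1
      then show ?thesis using mn code_cong[OF X(2,3) mn(3), of m] by simp
    next
      case 3
      then show ?thesis using mn code_cong[OF X(1,2) mn(1), of n] by simp
    qed (use mn in simp)
    then show ?thesis using ag unfolding lex_def by blast
  qed
  show "lex x y \<or> lex y x" if X: "x \<in> X" "y \<in> X" and ne: "x \<noteq> y" for x y
  proof -
    let ?n = "LEAST n. x n \<noteq> y n"
    have "\<exists>n. x n \<noteq> y n" using ne by auto
    then have "x ?n \<noteq> y ?n" by (rule LeastI_ex)
    moreover have ag: "agree ?n x y" unfolding agree_def using not_less_Least by blast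
    ultimately have "code x ?n \<noteq> code y ?n" using code_eq_iff X by blast
    then show ?thesis using ag agree_sym unfolding lex_def by (meson linorder_neqE)
  qed
  show "\<exists>z\<in>X. lex x z \<and> lex z y" if X: "x \<in> X" "y \<in> X" and "lex x y" for x y
  proof -
    obtain n where n: "agree n x y" "code x n < code y n" using \<open>lex x y\<close> unfolding lex_def by blast
    \<comment> \<open>Leaving entry \<open>n\<close> alone keeps \<open>z\<close> below
      \<open>y\<close>; raising the code one place later puts it above \<open>x\<close>.\<close>
    obtain z where z: "z \<in> X" "agree (Suc n) x z" "code z (Suc n) = code x (Suc n) + 1"
      using code_exists[OF X(1)] by blast
    have "lex x z" using z unfolding lex_def by (intro exI[of _ "Suc n"]) simp
    moreover have "agree n z y" using agree_trans[OF agree_sym[OF agree_le[OF z(2)]] n(1)] by simp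
    then have "lex z y" using n(2) code_cong[OF X(1) z(1,2), of n] unfolding lex_def by auto
    ultimately show ?thesis using z(1) by blast
  qed
  show "\<exists>y\<in>X. lex y x" if "x \<in> X" for x
    using code_exists[OF that, of 0 "code x 0 - 1"] unfolding lex_def agree_def by force
  show "\<exists>y\<in>X. lex x y" if "x \<in> X" for x
    using code_exists[OF that, of 0 "code x 0 + 1"] unfolding lex_def agree_def by force
qed

text \<open>Cylinders are convex: a first deviation before position \<open>n\<close> would put
  \<open>y\<close> outside the interval on one side.\<close>

lemma lex_between_agree:
  assumes X: "a \<in> X" "b \<in> X" "y \<in> X" and ab: "agree n a b" and lt: "lex a y" "lex y b"
  shows "agree n a y"
proof (rule ccontr)
  assume neg: "\<not> agree n a y"
  obtain m where m: "agree m a y" "code a m < code y m" using lt unfolding lex_def by blast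
  obtain k where k: "agree k y b" "code y k < code b k" using lt unfolding lex_def by blast
  have "m < n" using m(1) neg agree_le by (meson not_less)
  have cab: "code a i = code b i" if "i < n" for i using code_cong[OF X(1,2) ab that] .
  consider "k < m" | "k = m" | "m < k" by linarith
  then show False
  proof cases
    case 1
    then show ?thesis using code_cong[OF X(1,3) m(1) 1] cab[of k] k(2) \<open>m < n\<close> by simp
  next
    case 2
    then show ?thesis using cab[OF \<open>m < n\<close>] m(2) k(2) by simp
  next
    case 3
    then show ?thesis using code_cong[OF X(3,2) k(1) 3] cab[OF \<open>m < n\<close>] m(2) by simp
  qed
qed

theorem rational_enumeration:
  obtains h where "bij_betw h X \<rat>"
    "\<And>U. U \<subseteq> \<rat> \<Longrightarrow> openin Qtop U \<longleftrightarrow>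
      (\<forall>x\<in>X. h x \<in> U \<longrightarrow> (\<exists>n. \<forall>y\<in>X. agree n x y \<longrightarrow> h y \<in> U))"
proof -
  obtain h where h: "bij_betw h X (\<rat> :: real set)"
    and h_less: "\<And>x y. x \<in> X \<Longrightarrow> y \<in> X \<Longrightarrow> lex x y \<longleftrightarrow> h x < h y"
    using cantor_isomorphism[OF countable_dense_order_lex countable_dense_order_Rats] by metis
  have h_Rats: "h x \<in> \<rat>" if "x \<in> X" for x using h that bij_betwE by blast
  have h_surj: "\<exists>x\<in>X. h x = q" if "q \<in> \<rat>" for q
    using bij_betw_imp_surj_on[OF h] that by (metis imageE)
  have "openin Qtop U \<longleftrightarrow> (\<forall>x\<in>X. h x \<in> U \<longrightarrow> (\<exists>n. \<forall>y\<in>X. agree n x y \<longrightarrow> h y \<in> U))"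
    if U: "U \<subseteq> \<rat>" for U
  proof
    assume "openin Qtop U"
    then obtain T where T: "open T" "U = T \<inter> \<rat>"
      unfolding Qtop_def openin_subtopology open_openin[symmetric] by blast
    show "\<forall>x\<in>X. h x \<in> U \<longrightarrow> (\<exists>n. \<forall>y\<in>X. agree n x y \<longrightarrow> h y \<in> U)"
    proof (intro ballI impI)
      fix x assume x: "x \<in> X" "h x \<in> U"
      then obtain e where e: "e > 0" "\<And>q. \<bar>q - h x\<bar> < e \<Longrightarrow> q \<in> T"
        using T unfolding open_dist dist_real_def by blast
      obtain p q where pq: "p \<in> \<rat>" "h x - e < p" "p < h x" "q \<in> \<rat>" "h x < q" "q < h x + e"
        using Rats_dense_in_real[of "h x - e" "h x"] Rats_dense_in_real[of "h x" "h x + e"] e(1)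
        by auto
      obtain a b where ab: "a \<in> X" "h a = p" "b \<in> X" "h b = q" using h_surj pq by metis
      then obtain m k where mk: "agree m a x" "code a m < code x m" "agree k x b" "code x k < code b k"
        using h_less x pq unfolding lex_def by metis
      \<comment> \<open>Beyond the positions \<open>m\<close> and \<open>k\<close> at which
        \<open>a\<close> and \<open>b\<close> first differ from \<open>x\<close>, a sequence
        compares with both as \<open>x\<close> does.\<close>
      have "h y \<in> U" if y: "y \<in> X" "agree (Suc (max m k)) x y" for y
      proof -
        have "agree m a y" "agree k y b"
          using agree_trans[OF mk(1) agree_le[OF y(2)]]
            agree_trans[OF agree_sym[OF agree_le[OF y(2)]] mk(3)] by auto
        moreover have "code x m = code y m" "code x k = code y k"
          using code_cong[OF x(1) y] by auto
        ultimately have "lex a y" "lex y b" using mk unfolding lex_def by auto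
        then have "p < h y" "h y < q" using h_less ab y(1) by auto
        then have "\<bar>h y - h x\<bar> < e" using pq by linarith
        then show ?thesis using e(2) T(2) h_Rats[OF y(1)] by blast
      qed
      then show "\<exists>n. \<forall>y\<in>X. agree n x y \<longrightarrow> h y \<in> U" by blast
    qed
  next
    assume R: "\<forall>x\<in>X. h x \<in> U \<longrightarrow> (\<exists>n. \<forall>y\<in>X. agree n x y \<longrightarrow> h y \<in> U)"
    show "openin Qtop U"
    proof (subst openin_subopen, intro ballI)
      fix q assume "q \<in> U"
      then obtain x where x: "x \<in> X" "h x = q" using h_surj U by blast
      then obtain n where n: "\<And>y. y \<in> X \<Longrightarrow> agree n x y \<Longrightarrow> h y \<in> U" using R \<open>q \<in> U\<close> by blast
      \<comment> \<open>Siblings of \<open>x\<close> at entry \<open>n\<close> with neighbouring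
        codes: by convexity the open interval between them lies in the cylinder.\<close>
      obtain a where a: "a \<in> X" "agree n x a" "code a n = code x n - 1" using code_exists[OF x(1)] by blast
      obtain b where b: "b \<in> X" "agree n x b" "code b n = code x n + 1" using code_exists[OF x(1)] by blast
      have ab: "agree n a b" using agree_trans[OF agree_sym[OF a(2)] b(2)] .
      have "lex a x" "lex x b" using a b agree_sym[OF a(2)] unfolding lex_def by (metis less_add_one diff_add_cancel)+
      then have "h a < q" "q < h b" using h_less a b x by auto
      moreover have "h y \<in> U" if y: "y \<in> X" "h a < h y" "h y < h b" for y
      proof -
        have "agree n a y" using lex_between_agree[OF a(1) b(1) y(1) ab] h_less a b y by blast
        then show ?thesis using n[OF y(1)] agree_trans[OF a(2)] by blast
      qed
      then have "{h a<..<h b} \<inter> \<rat> \<subseteq> U" using h_surj by fastforce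
      moreover have "openin Qtop ({h a<..<h b} \<inter> \<rat>)"
        unfolding Qtop_def openin_subtopology open_openin[symmetric] by (blast intro: open_greaterThanLessThan)
      moreover have "q \<in> \<rat>" using \<open>q \<in> U\<close> U by blast
      ultimately show "\<exists>T. openin Qtop T \<and> q \<in> T \<and> T \<subseteq> U"
        by (intro exI[of _ "{h a<..<h b} \<inter> \<rat>"]) auto
    qed
  qed
  then show thesis using that h by blast
qed

end

section \<open>Realising quasimodels on the rational numbers\<close>

context quasimodel
begin

section \<open>Paths fulfilling their eventualities\<close>

definition path :: "(nat \<Rightarrow> 'w) \<Rightarrow> bool" where
  "path b \<longleftrightarrow> (\<forall>i. S (b i) (b (Suc i)))"

definition realizing :: "(nat \<Rightarrow> 'w) \<Rightarrow> bool" where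
  "realizing b \<longleftrightarrow> path b \<and>
    (\<forall>i a. Dia a \<in> Sg \<longrightarrow> Dia a \<in> lab (b i) \<longrightarrow> (\<exists>j\<ge>i. a \<in> lab (b j)))"

lemma path_I: "path b \<Longrightarrow> b i \<in> I"
  unfolding path_def using S_I by blast

lemma Dia_persists:
  assumes b: "path b" and a: "Dia a \<in> Sg" "Dia a \<in> lab (b i)"
  shows "(\<exists>k. i \<le> k \<and> k < i + n \<and> a \<in> lab (b k)) \<or> Dia a \<in> lab (b (i + n))"
proof (induction n)
  case (Suc n)
  have "S (b (i + n)) (b (Suc (i + n)))" using b unfolding path_def by blast
  from lab_Dia[OF this a(1)] Suc show ?case
    by (metis add_Suc_right le_add1 less_Suc_eq)
qed (use a in simp)

text \<open>A pending eventuality is either met within the prefix or handed on to the tail. Finite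
  modifications at the start are thus harmless, as long as the result is a path.\<close>

lemma realizing_prefix:
  assumes b: "path b" and t: "realizing (\<lambda>i. b (N + i))"
  shows "realizing b"
  unfolding realizing_def
proof (intro conjI allI impI)
  fix i a assume a: "Dia a \<in> Sg" "Dia a \<in> lab (b i)"
  have tail: "\<exists>j\<ge>i. a \<in> lab (b j)" if le: "N \<le> m" "i \<le> m" and m: "Dia a \<in> lab (b m)" for m
  proof -
    have "Dia a \<in> lab (b (N + (m - N)))" using le m by simp
    then obtain j where "j \<ge> m - N" "a \<in> lab (b (N + j))"
      using t a(1) unfolding realizing_def by blast
    then show ?thesis using le by (intro exI[of _ "N + j"]) simp
  qed
  from Dia_persists[OF b a, of N] show "\<exists>j\<ge>i. a \<in> lab (b j)"
    using tail[of "i + N"] by auto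
qed (rule b)

text \<open>The path keeps a pointer into a list running cyclically through all formulas.  While the
  eventuality under the pointer is pending, each step brings its fulfilment closer; otherwise the
  pointer advances.\<close>

lemma realizing_path_exists:
  assumes w: "w \<in> I"
  shows "\<exists>b. b 0 = w \<and> realizing b"
proof -
  obtain es where es: "set es = Sg" using finite_list[OF finite_Sg] by blast
  define e where "e j = es ! (j mod length es)" for j
  define pend where "pend u a \<longleftrightarrow> Dia a \<in> Sg \<and> Dia a \<in> lab u \<and> a \<notin> lab u" for u a
  define d where "d u a = (LEAST n. \<exists>v. (S ^^ n) u v \<and> a \<in> lab v)" for u a
  have closer: "\<exists>v. S u v \<and> (pend u a \<longrightarrow> d v a < d u a)" if u: "u \<in> I" for u a
  proof (cases "pend u a")
    case True
    then have "\<exists>n v. (S ^^ n) u v \<and> a \<in> lab v"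
      using eventuality[OF u] unfolding pend_def rtranclp_power by blast
    then have "\<exists>v. (S ^^ d u a) u v \<and> a \<in> lab v" unfolding d_def by (rule LeastI_ex)
    then obtain v where v: "(S ^^ d u a) u v" "a \<in> lab v" by blast
    have "d u a \<noteq> 0"
    proof
      assume "d u a = 0"
      then have "u = v" using v(1) by simp
      then show False using v(2) True unfolding pend_def by blast
    qed
    then obtain n where n: "d u a = Suc n" using not0_implies_Suc by blast
    then obtain x where x: "S u x" "(S ^^ n) x v" using v(1) relpowp_Suc_D2 by metis
    then have "d x a \<le> n" unfolding d_def using v(2) by (intro Least_le) blast
    then show ?thesis using x(1) n by auto
  next
    case False
    then show ?thesis using serial[OF u] by blast
  qed
  define P where "P s \<longleftrightarrow> fst s \<in> I" for s :: "'w \<times> nat"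
  define Q where "Q s s' \<longleftrightarrow> S (fst s) (fst s') \<and>
    (if pend (fst s) (e (snd s)) then snd s' = snd s \<and> d (fst s') (e (snd s)) < d (fst s) (e (snd s))
     else snd s' = Suc (snd s))" for s s' :: "'w \<times> nat"
  \<comment> \<open>Dependent choice leaves the first value free; the clause for
    \<open>n = 0\<close> pins it.\<close>
  have "\<exists>f. \<forall>n. (P (f n) \<and> (n = 0 \<longrightarrow> f n = (w, 0))) \<and> Q (f n) (f (Suc n))"
  proof (rule dependent_nat_choice)
    show "\<exists>s. P s \<and> (0 = 0 \<longrightarrow> s = (w, 0))" using w unfolding P_def by auto
    fix s :: "'w \<times> nat" and n :: nat assume "P s \<and> (n = 0 \<longrightarrow> s = (w, 0))"
    then obtain v where v: "S (fst s) v" "pend (fst s) (e (snd s)) \<longrightarrow> d v (e (snd s)) < d (fst s) (e (snd s))"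
      using closer unfolding P_def by blast
    then have "Q s (v, if pend (fst s) (e (snd s)) then snd s else Suc (snd s))" unfolding Q_def by simp
    moreover have "v \<in> I" using v(1) S_I by blast
    ultimately show "\<exists>s'. (P s' \<and> (Suc n = 0 \<longrightarrow> s' = (w, 0))) \<and> Q s s'" unfolding P_def by force
  qed
  then obtain f where f: "\<And>n. P (f n)" "f 0 = (w, 0)" "\<And>n. Q (f n) (f (Suc n))" by metis
  define b where "b n = fst (f n)" for n
  define k where "k n = snd (f n)" for n
  have b0: "b 0 = w" and k0: "k 0 = 0" using f(2) unfolding b_def k_def by simp_all
  have b_path: "path b" using f(3) unfolding path_def b_def Q_def by blast
  have wait: "k (Suc n) = k n \<and> d (b (Suc n)) (e (k n)) < d (b n) (e (k n))"
    if "pend (b n) (e (k n))" for n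
    using f(3)[of n] that unfolding b_def k_def Q_def by simp
  have advance: "k (Suc n) = Suc (k n)" if "\<not> pend (b n) (e (k n))" for n
    using f(3)[of n] that unfolding b_def k_def Q_def by simp
  \<comment> \<open>The pointer cannot stay put forever, since the distance \<open>d\<close> drops
    at every waiting step.\<close>
  have settle: "\<exists>m. k m = k n \<and> \<not> pend (b m) (e (k m))" for n
  proof (induction "d (b n) (e (k n))" arbitrary: n rule: less_induct)
    case less
    show ?case
    proof (cases "pend (b n) (e (k n))")
      case True
      then have "k (Suc n) = k n" "d (b (Suc n)) (e (k (Suc n))) < d (b n) (e (k n))"
        using wait[OF True] by simp_all
      then show ?thesis using less[of "Suc n"] by auto
    next
      case False
      then show ?thesis by blast
    qed
  qed
  have reach: "\<exists>m. k m = j \<and> \<not> pend (b m) (e j)" for j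
  proof (induction j)
    case 0
    then show ?case using settle[of 0] k0 by metis
  next
    case (Suc j)
    then obtain m where "k m = j" "\<not> pend (b m) (e j)" by blast
    then have "k (Suc m) = Suc j" using advance[of m] by simp
    then show ?case using settle[of "Suc m"] by metis
  qed
  have k_le: "k n \<le> n" for n
  proof (induction n)
    case (Suc n)
    then show ?case using wait[of n] advance[of n] by (cases "pend (b n) (e (k n))") auto
  qed (simp add: k0)
  have "\<exists>j\<ge>i. a \<in> lab (b j)" if a: "Dia a \<in> Sg" "Dia a \<in> lab (b i)" for i a
  proof -
    have "a \<in> set es" using a(1) Sg_closed es unfolding subformula_closed_def by blast
    then obtain p where p: "p < length es" "es ! p = a" by (metis in_set_conv_nth)
    \<comment> \<open>An occurrence of \<open>a\<close> in the cyclic list at a position not before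
      \<open>i\<close>. As the pointer advances by at most one per step, it arrives there no earlier
      than time \<open>i\<close>.\<close>
    define j where "j = p + length es * i"
    have "1 \<le> length es" using p(1) by simp
    then have "i \<le> length es * i" using mult_le_mono1[of 1 "length es" i] by simp
    then have "i \<le> j" unfolding j_def by (rule trans_le_add2)
    moreover have "e j = a" using p unfolding e_def j_def by simp
    ultimately have j: "e j = a" "i \<le> j" by blast+
    obtain m where m: "k m = j" "\<not> pend (b m) a" using reach[of j] j(1) by blast
    then have "i \<le> m" using k_le[of m] j(2) by simp
    then obtain n where n: "m = i + n" using le_Suc_ex by blast
    from Dia_persists[OF b_path a, of n] show ?thesis
      using m(2) a(1) \<open>i \<le> m\<close> unfolding n pend_def by blast
  qed
  then have "realizing b" using b_path unfolding realizing_def by blast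
  then show ?thesis using b0 by blast
qed

definition realizer :: "'w \<Rightarrow> nat \<Rightarrow> 'w" where
  "realizer w = (SOME b. b 0 = w \<and> realizing b)"

lemma realizer: "w \<in> I \<Longrightarrow> realizer w 0 = w \<and> realizing (realizer w)"
  unfolding realizer_def using someI_ex[OF realizing_path_exists] by blast

text \<open>Countably many realizing paths suffice: those that eventually follow a chosen one.\<close>

definition tame :: "(nat \<Rightarrow> 'w) set" where
  "tame = {b. path b \<and> (\<exists>n m. \<exists>w\<in>I. \<forall>i. b (n + i) = realizer w (m + i))}"

lemma realizing_shift:
  assumes b: "realizing b"
  shows "realizing (\<lambda>i. b (m + i))"
  unfolding realizing_def
proof (intro conjI allI impI)
  show "path (\<lambda>i. b (m + i))" using b unfolding realizing_def path_def by simp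
  fix i a assume "Dia a \<in> Sg" "Dia a \<in> lab (b (m + i))"
  then obtain j where "m + i \<le> j" "a \<in> lab (b j)" using b unfolding realizing_def by blast
  then show "\<exists>j\<ge>i. a \<in> lab (b (m + j))" by (intro exI[of _ "j - m"]) simp
qed

lemma tame_path: "b \<in> tame \<Longrightarrow> path b"
  unfolding tame_def by blast

lemma tame_realizing:
  assumes "b \<in> tame"
  shows "realizing b"
proof -
  obtain n m w where w: "w \<in> I" "\<And>i. b (n + i) = realizer w (m + i)"
    using assms unfolding tame_def by blast
  have "realizing (\<lambda>i. realizer w (m + i))" using realizing_shift realizer[OF w(1)] by blast
  then have "realizing (\<lambda>i. b (n + i))" using w(2) by simp
  then show ?thesis using realizing_prefix tame_path[OF assms] by blast
qed

lemma tame_tail: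
  assumes "b \<in> tame"
  shows "(\<lambda>i. b (Suc i)) \<in> tame"
proof -
  obtain n m w where w: "w \<in> I" "\<And>i. b (n + i) = realizer w (m + i)"
    using assms unfolding tame_def by blast
  have "b (Suc (n + i)) = realizer w (Suc m + i)" for i using w(2)[of "Suc i"] by simp
  moreover have "path (\<lambda>i. b (Suc i))" using tame_path[OF assms] unfolding path_def by blast
  ultimately show ?thesis using w(1) unfolding tame_def by blast
qed

lemma countable_eventually:
  assumes C: "countable C" and D: "countable D"
  shows "countable {x :: nat \<Rightarrow> 'c. (\<forall>i. x i \<in> C) \<and> (\<exists>n. \<exists>t\<in>D. \<forall>i. x (n + i) = t i)}"
proof (rule countable_subset)
  let ?F = "\<lambda>(xs, t). \<lambda>i. if i < length xs then xs ! i else t (i - length xs)"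
  show "countable (?F ` (lists C \<times> D))" using C D by (intro countable_image countable_SIGMA) auto
  show "{x. (\<forall>i. x i \<in> C) \<and> (\<exists>n. \<exists>t\<in>D. \<forall>i. x (n + i) = t i)} \<subseteq> ?F ` (lists C \<times> D)"
  proof
    fix x assume "x \<in> {x. (\<forall>i. x i \<in> C) \<and> (\<exists>n. \<exists>t\<in>D. \<forall>i. x (n + i) = t i)}"
    then obtain n t where x: "\<And>i. x i \<in> C" "t \<in> D" "\<And>i. x (n + i) = t i" by blast
    have "x i = ?F (map x [0..<n], t) i" for i using x(3)[of "i - n"] by auto
    moreover have "map x [0..<n] \<in> lists C" using x(1) by auto
    ultimately show "x \<in> ?F ` (lists C \<times> D)" using x(2) by (intro image_eqI[of _ _ "(map x [0..<n], t)"]) auto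
  qed
qed

lemma countable_tame: "countable tame"
proof -
  let ?D = "(\<lambda>(m, w) i. realizer w (m + i)) ` (UNIV \<times> I)"
  have "countable ?D" using finite_I by (intro countable_image countable_SIGMA) (auto intro: countable_finite)
  from countable_eventually[OF countable_finite[OF finite_I] this]
  show ?thesis
    by (rule countable_subset[rotated]) (force simp: tame_def path_I)
qed

text \<open>Confluence yields a path from \<open>v\<close> above \<open>b\<close>, perhaps neither
  tame nor realizing. Only its first entries up to \<open>N\<close> are kept, and a chosen realizer
  takes over.\<close>

lemma tame_jump:
  assumes b: "b \<in> tame" and v: "le (b 0) v"
  shows "\<exists>b'\<in>tame. b' 0 = v \<and> (\<forall>i\<le>N. le (b i) (b' i))"
proof -
  have "\<exists>c. \<forall>n. (le (b n) (c n) \<and> (n = 0 \<longrightarrow> c n = v)) \<and> S (c n) (c (Suc n))"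
  proof (rule dependent_nat_choice)
    show "\<exists>x. le (b 0) x \<and> (0 = 0 \<longrightarrow> x = v)" using v by blast
    fix x and n :: nat assume "le (b n) x \<and> (n = 0 \<longrightarrow> x = v)"
    moreover have "S (b n) (b (Suc n))" using tame_path[OF b] unfolding path_def by blast
    ultimately show "\<exists>y. (le (b (Suc n)) y \<and> (Suc n = 0 \<longrightarrow> y = v)) \<and> S x y"
      using confluent by blast
  qed
  then obtain c where c: "\<And>n. le (b n) (c n)" "c 0 = v" "\<And>n. S (c n) (c (Suc n))" by auto
  have cN: "c N \<in> I" using c(3) S_I by blast
  \<comment> \<open>The pieces meet at \<open>N\<close>, because \<open>realizer (c N)\<close>
    starts at \<open>c N\<close>.\<close>
  define b' where "b' i = (if i \<le> N then c i else realizer (c N) (i - N))" for i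
  have tail: "b' (N + i) = realizer (c N) (0 + i)" for i
    unfolding b'_def using realizer[OF cN] by simp
  have "S (b' i) (b' (Suc i))" for i
  proof (cases "i < N")
    case True
    then show ?thesis using c(3) unfolding b'_def by simp
  next
    case False
    then obtain l where l: "i = N + l" using le_Suc_ex by (metis not_less)
    have "S (realizer (c N) l) (realizer (c N) (Suc l))"
      using realizer[OF cN] unfolding realizing_def path_def by blast
    then show ?thesis using tail[of l] tail[of "Suc l"] l by simp
  qed
  then have "b' \<in> tame" using tail cN unfolding tame_def path_def by blast
  moreover have "b' 0 = v" "\<forall>i\<le>N. le (b i) (b' i)" using c unfolding b'_def by auto
  ultimately show ?thesis by blast
qed

section \<open>Points as sequences of approximations\<close>

text \<open>A point is an eventually constant sequence of finer and finer approximations to a path; the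
  \<open>n\<close>-th approximation binds the later ones in its first \<open>Suc n\<close> entries only.  The natural
  numbers attached to the approximations provide infinitely many continuations of each finite
  sequence of approximations.\<close>

definition points :: "(nat \<Rightarrow> nat \<times> (nat \<Rightarrow> 'w)) set" where
  "points = {x. (\<exists>N. \<forall>n\<ge>N. x n = x N) \<and> (\<forall>n. snd (x n) \<in> tame) \<and>
    (\<forall>n. \<forall>i\<le>n. le (snd (x n) i) (snd (x (Suc n)) i))}"

definition limit :: "(nat \<Rightarrow> nat \<times> (nat \<Rightarrow> 'w)) \<Rightarrow> nat \<Rightarrow> 'w" where
  "limit x = snd (x (SOME N. \<forall>n\<ge>N. x n = x N))"

text \<open>One approximation and one entry of each path are dropped together. Approximation
  \<open>Suc n\<close> binds the entries up to \<open>Suc n\<close>, so after the loss of entry 0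
  exactly the bound required at index \<open>n\<close> remains.\<close>

definition shift :: "(nat \<Rightarrow> nat \<times> (nat \<Rightarrow> 'w)) \<Rightarrow> nat \<Rightarrow> nat \<times> (nat \<Rightarrow> 'w)" where
  "shift x n = (fst (x (Suc n)), \<lambda>i. snd (x (Suc n)) (Suc i))"

lemma limit_eq:
  assumes "\<And>n. N \<le> n \<Longrightarrow> x n = x N"
  shows "limit x = snd (x N)"
proof -
  define M where "M = (SOME N. \<forall>n\<ge>N. x n = x N)"
  have "\<exists>N. \<forall>n\<ge>N. x n = x N" using assms by (intro exI[of _ N] allI impI)
  from someI_ex[OF this] have "\<forall>n\<ge>M. x n = x M" unfolding M_def .
  then have "x (max N M) = x M" using max.cobounded2 by blast
  moreover have "x (max N M) = x N" by (rule assms) simp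
  ultimately show ?thesis unfolding limit_def M_def[symmetric] by simp
qed

lemma points_limit:
  assumes "x \<in> points"
  obtains N where "\<And>n. N \<le> n \<Longrightarrow> x n = x N" "limit x = snd (x N)"
proof -
  obtain N where N: "\<And>n. N \<le> n \<Longrightarrow> x n = x N" using assms unfolding points_def by blast
  show thesis using that[of N, OF N limit_eq[of N x, OF N]] .
qed

lemma points_tame: "x \<in> points \<Longrightarrow> snd (x n) \<in> tame"
  unfolding points_def by blast

lemma limit_attained: "x \<in> points \<Longrightarrow> \<exists>N. limit x = snd (x N)"
  by (erule points_limit) (rule exI)

lemma limit_tame: "x \<in> points \<Longrightarrow> limit x \<in> tame"
  using limit_attained[of x] points_tame[of x] by auto

lemma limit_I: "x \<in> points \<Longrightarrow> limit x i \<in> I"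
  using limit_tame tame_path path_I by blast

lemma points_le: "x \<in> points \<Longrightarrow> i \<le> n \<Longrightarrow> le (snd (x n) i) (snd (x (n + k)) i)"
proof (induction k)
  case 0
  then show ?case using points_tame tame_path path_I le_refl by (metis add_0_right)
next
  case (Suc k)
  then have "le (snd (x (n + k)) i) (snd (x (Suc (n + k))) i)"
    unfolding points_def by auto
  then show ?case using Suc le_trans by (metis add_Suc_right)
qed

lemma points_le_limit:
  assumes x: "x \<in> points" and "i \<le> n"
  shows "le (snd (x n) i) (limit x i)"
proof -
  obtain N where N: "\<And>n. N \<le> n \<Longrightarrow> x n = x N" "limit x = snd (x N)"
    by (rule points_limit[OF x], rule that)
  show ?thesis using points_le[OF assms, of N] N(1)[of "n + N"] N(2) by simp
qed

lemma points_extend: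
  fixes k :: nat
  assumes x: "x \<in> points" and b: "b \<in> tame" "\<And>m i. m < n \<Longrightarrow> i \<le> m \<Longrightarrow> le (snd (x m) i) (b i)"
  defines "y \<equiv> \<lambda>m. if m < n then x m else (k, b)"
  shows "y \<in> points" "agree n x y" "limit y = b" "y n = (k, b)"
proof -
  have const: "y m = y n" if "n \<le> m" for m using that unfolding y_def by simp
  show yn: "y n = (k, b)" unfolding y_def by simp
  show "limit y = b" using limit_eq[of n y, OF const] yn by simp
  show "agree n x y" unfolding agree_def y_def by simp
  have "le (snd (y m) i) (snd (y (Suc m)) i)" if i: "i \<le> m" for m i
  proof -
    consider "Suc m < n" | "m < n" "\<not> Suc m < n" | "\<not> m < n" by linarith
    then show ?thesis
    proof cases
      case 1
      then show ?thesis using x i unfolding points_def y_def by simp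
    next
      case 2
      then show ?thesis using b(2)[OF 2(1) i] unfolding y_def by simp
    next
      case 3
      then show ?thesis using le_refl path_I[OF tame_path[OF b(1)]] unfolding y_def by simp
    qed
  qed
  moreover have "snd (y m) \<in> tame" for m using points_tame[OF x] b(1) unfolding y_def by simp
  ultimately show "y \<in> points" unfolding points_def using const by blast
qed

lemma points_const: "b \<in> tame \<Longrightarrow> (\<lambda>n. (0, b)) \<in> points"
  unfolding points_def using le_refl path_I tame_path by auto

lemma shift_points:
  assumes x: "x \<in> points"
  shows "shift x \<in> points" "limit (shift x) = (\<lambda>i. limit x (Suc i))"
proof -
  obtain N where N: "\<And>n. N \<le> n \<Longrightarrow> x n = x N" "limit x = snd (x N)"
    by (rule points_limit[OF x], rule that)
  have const: "shift x n = shift x N" if "N \<le> n" for n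
    using N(1)[of "Suc n"] N(1)[of "Suc N"] that unfolding shift_def by simp
  show "limit (shift x) = (\<lambda>i. limit x (Suc i))"
    using limit_eq[of N "shift x", OF const] N(1)[of "Suc N"] N(2) unfolding shift_def by simp
  have "snd (shift x n) \<in> tame" for n using tame_tail points_tame[OF x] unfolding shift_def by simp
  moreover have "le (snd (shift x n) i) (snd (shift x (Suc n)) i)" if "i \<le> n" for n i
    using x that unfolding shift_def points_def by simp
  ultimately show "shift x \<in> points" unfolding points_def using const by blast
qed

lemma shift_agree: "agree (Suc n) x y \<Longrightarrow> agree n (shift x) (shift y)"
  unfolding agree_def shift_def by auto

lemma shift_funpow:
  assumes "x \<in> points"
  shows "(shift ^^ n) x \<in> points \<and> limit ((shift ^^ n) x) = (\<lambda>i. limit x (n + i))"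
  by (induction n) (use assms shift_points in auto)

text \<open>Once the stage at which \<open>x\<close> attains its limit is shared, the order on entry
  0 binds every later approximation of \<open>y\<close>.\<close>

lemma limit_continuous:
  assumes "x \<in> points"
  shows "\<exists>n. \<forall>y\<in>points. agree n x y \<longrightarrow> le (limit x 0) (limit y 0)"
proof -
  obtain N where N: "limit x = snd (x N)" using limit_attained[OF assms] by blast
  have "le (limit x 0) (limit y 0)" if y: "y \<in> points" "agree (Suc N) x y" for y
    using points_le_limit[OF y(1), of 0 N] N y(2) unfolding agree_def by simp
  then show ?thesis by blast
qed

text \<open>The first \<open>n\<close> approximations bind only entries below \<open>n\<close>,
  where the path from \<open>tame_jump\<close> stays above the limit; it may therefore become the
  new constant tail.\<close>

lemma limit_open:
  assumes x: "x \<in> points" and v: "le (limit x 0) v"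
  shows "\<exists>y\<in>points. agree n x y \<and> limit y 0 = v"
proof -
  obtain b where b: "b \<in> tame" "b 0 = v" "\<And>i. i \<le> n \<Longrightarrow> le (limit x i) (b i)"
    using tame_jump[OF limit_tame[OF x] v] by blast
  have "le (snd (x m) i) (b i)" if "m < n" "i \<le> m" for m i
    using points_le_limit[OF x that(2)] b(3)[of i] that le_trans by (meson less_imp_le order_trans)
  note e = points_extend[where k = 0 and n = n, OF x b(1) this]
  show ?thesis by (rule bexI[OF _ e(1)]) (simp only: e(2,3) b(2) simp_thms)
qed

lemma branching_points: "I \<noteq> {} \<Longrightarrow> branching_sequences points"
proof
  let ?D = "(\<lambda>a i. a) ` (UNIV \<times> tame)"
  have "countable (UNIV \<times> tame :: (nat \<times> (nat \<Rightarrow> 'w)) set)" using countable_tame by auto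
  from countable_eventually[OF this countable_image[OF this, of "\<lambda>a i. a"]]
  show "countable points"
  proof (rule countable_subset[rotated])
    show "points \<subseteq> {x. (\<forall>i. x i \<in> UNIV \<times> tame) \<and> (\<exists>n. \<exists>t\<in>?D. \<forall>i. x (n + i) = t i)}"
    proof
      fix x assume x: "x \<in> points"
      have xt: "x i \<in> UNIV \<times> tame" for i using points_tame[OF x, of i] by (cases "x i") auto
      obtain N where N: "\<And>n. N \<le> n \<Longrightarrow> x n = x N"
    by (rule points_limit[OF x], rule that)
      have "\<forall>i. x (N + i) = (\<lambda>i. x N) i" by (intro allI N le_add1)
      moreover have "(\<lambda>i. x N) \<in> ?D" using xt by blast
      ultimately have "\<exists>n. \<exists>t\<in>?D. \<forall>i. x (n + i) = t i" by (intro exI bexI)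
      then show "x \<in> {x. (\<forall>i. x i \<in> UNIV \<times> tame) \<and> (\<exists>n. \<exists>t\<in>?D. \<forall>i. x (n + i) = t i)}"
        using xt by blast
    qed
  qed
  show "infinite {y n |y. y \<in> points \<and> agree n x y}" if x: "x \<in> points" for x n
  proof -
    \<comment> \<open>Keep the prefix and the path of \<open>x n\<close>, vary the tag freely and
      stay constant afterwards.\<close>
    have "(k, snd (x n)) \<in> {y n |y. y \<in> points \<and> agree n x y}" for k
    proof -
      have "le (snd (x m) i) (snd (x n) i)" if "m < n" "i \<le> m" for m i
        using points_le[OF x that(2), of "n - m"] that(1) by simp
      note e = points_extend[where k = k and n = n, OF x points_tame[OF x] this]
      show ?thesis
        by (rule CollectI, rule exI[of _ "\<lambda>m. if m < n then x m else (k, snd (x n))"])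
          (intro conjI e(1,2), simp)
    qed
    then have "range (\<lambda>k. (k, snd (x n))) \<subseteq> {y n |y. y \<in> points \<and> agree n x y}" by blast
    moreover have "infinite (range (\<lambda>k :: nat. (k, snd (x n))))"
      by (intro range_inj_infinite) (auto simp: inj_def)
    ultimately show ?thesis using finite_subset by blast
  qed
next
  assume "I \<noteq> {}"
  then obtain w where "w \<in> I" by blast
  then have "realizer w \<in> tame" using realizer unfolding tame_def realizing_def by blast
  then show "points \<noteq> {}" using points_const by blast
qed

section \<open>Truth in the topological model and transfer to the rationals\<close>

lemma truth_lemma:
  fixes T :: "'a topology" and f :: "'a \<Rightarrow> 'a" and pt :: "'a \<Rightarrow> 'w"
  assumes f: "\<And>x. x \<in> topspace T \<Longrightarrow> f x \<in> topspace T"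
    and S: "\<And>x. x \<in> topspace T \<Longrightarrow> S (pt x) (pt (f x))"
    and surj: "pt ` topspace T = I"
    and cont: "\<And>x. x \<in> topspace T \<Longrightarrow> \<exists>U. openin T U \<and> x \<in> U \<and> (\<forall>y\<in>U. le (pt x) (pt y))"
    and opn: "\<And>U x v. openin T U \<Longrightarrow> x \<in> U \<Longrightarrow> le (pt x) v \<Longrightarrow> \<exists>y\<in>U. pt y = v"
    and real: "\<And>x a. x \<in> topspace T \<Longrightarrow> Dia a \<in> Sg \<Longrightarrow> Dia a \<in> lab (pt x) \<Longrightarrow>
      \<exists>n. a \<in> lab (pt ((f ^^ n) x))"
  defines "V \<equiv> \<lambda>p. {x \<in> topspace T. Var p \<in> lab (pt x)}"
  shows "openin T (V p)" "a \<in> Sg \<Longrightarrow> sem T f V a = {x \<in> topspace T. a \<in> lab (pt x)}"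
proof -
  have open_lab: "openin T {x \<in> topspace T. a \<in> lab (pt x)}" for a
  proof (subst openin_subopen, intro ballI)
    fix x assume x: "x \<in> {x \<in> topspace T. a \<in> lab (pt x)}"
    then obtain U where U: "openin T U" "x \<in> U" "\<forall>y\<in>U. le (pt x) (pt y)" using cont[of x] by auto
    have "U \<subseteq> {x \<in> topspace T. a \<in> lab (pt x)}"
    proof
      fix y assume y: "y \<in> U"
      then have "le (pt x) (pt y)" "y \<in> topspace T" using U(3) openin_subset[OF U(1)] by auto
      then show "y \<in> {x \<in> topspace T. a \<in> lab (pt x)}" using x lab_mono[of "pt x" "pt y"] by auto
    qed
    then show "\<exists>U. openin T U \<and> x \<in> U \<and> U \<subseteq> {x \<in> topspace T. a \<in> lab (pt x)}"
      using U by (intro exI[of _ U] conjI)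
  qed
  show "openin T (V p)" unfolding V_def by (rule open_lab)
  have I: "pt x \<in> I" if "x \<in> topspace T" for x using surj that by blast
  have fn: "(f ^^ n) x \<in> topspace T" if "x \<in> topspace T" for n x
    by (induction n) (use that f in auto)
  show "sem T f V a = {x \<in> topspace T. a \<in> lab (pt x)}" if "a \<in> Sg"
    using that
  proof (induction a)
    case Bot
    then show ?case using lab_Bot I by auto
  next
    case (Var p)
    then show ?case unfolding V_def by simp
  next
    case (And a b)
    then have "a \<in> Sg" "b \<in> Sg" using Sg_closed unfolding subformula_closed_def by blast+
    then show ?case using And lab_And[OF I And.prems] by auto
  next
    case (Or a b)
    then have "a \<in> Sg" "b \<in> Sg" using Sg_closed unfolding subformula_closed_def by blast+
    then show ?case using Or lab_Or[OF I Or.prems] by auto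
  next
    case (Imp a b)
    then have ab: "a \<in> Sg" "b \<in> Sg" using Sg_closed unfolding subformula_closed_def by blast+
    let ?A = "topspace T - sem T f V a \<union> sem T f V b"
    have A: "?A = {x \<in> topspace T. a \<in> lab (pt x) \<longrightarrow> b \<in> lab (pt x)}" using Imp ab by auto
    have "T interior_of ?A = {x \<in> topspace T. Imp a b \<in> lab (pt x)}"
    proof (rule interior_of_unique)
      show "{x \<in> topspace T. Imp a b \<in> lab (pt x)} \<subseteq> ?A"
        unfolding A using lab_Imp[OF I Imp.prems] le_refl[OF I] by blast
      show "openin T {x \<in> topspace T. Imp a b \<in> lab (pt x)}" by (rule open_lab)
      fix U assume U: "U \<subseteq> ?A" "openin T U"
      show "U \<subseteq> {x \<in> topspace T. Imp a b \<in> lab (pt x)}"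
      proof
        \<comment> \<open>Openness of \<open>pt\<close> is used here: every world above
          \<open>pt x\<close> is attained inside the neighbourhood \<open>U\<close>, so truth
          throughout \<open>U\<close> reaches all worlds quantified over in
          \<open>lab_Imp\<close>.\<close>
        fix x assume x: "x \<in> U"
        then have xT: "x \<in> topspace T" using openin_subset[OF U(2)] by blast
        have "b \<in> lab v" if v: "le (pt x) v" "a \<in> lab v" for v
        proof -
          obtain y where "y \<in> U" "pt y = v" using opn[OF U(2) x v(1)] by blast
          then show ?thesis using U(1) v(2) unfolding A by blast
        qed
        then show "x \<in> {x \<in> topspace T. Imp a b \<in> lab (pt x)}"
          using lab_Imp[OF I[OF xT] Imp.prems] xT by blast
      qed
    qed
    then show ?case by simp
  next
    case (Next a)
    then have "a \<in> Sg" using Sg_closed unfolding subformula_closed_def by blast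
    then show ?case using Next lab_Next[OF S Next.prems] f by auto
  next
    case (Dia a)
    then have a: "a \<in> Sg" using Sg_closed unfolding subformula_closed_def by blast
    have "Dia a \<in> lab (pt x)" if "x \<in> topspace T" "a \<in> lab (pt ((f ^^ n) x))" for n x
      using that
    proof (induction n arbitrary: x)
      case 0
      then show ?case using lab_Dia[OF S Dia.prems] by simp
    next
      case (Suc n)
      then have "Dia a \<in> lab (pt (f x))" using f by (simp add: funpow_Suc_right del: funpow.simps)
      then show ?case using lab_Dia[OF S[OF Suc.prems(1)] Dia.prems] by blast
    qed
    then show ?case using Dia.IH[OF a] real[OF _ Dia.prems] fn by auto
  next
    case (All a)
    then have a: "a \<in> Sg" using Sg_closed unfolding subformula_closed_def by blast
    have "sem T f V a = topspace T \<longleftrightarrow> (\<forall>x\<in>topspace T. a \<in> lab (pt x))"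
      using All.IH[OF a] by blast
    also have "\<dots> \<longleftrightarrow> (\<forall>v\<in>I. a \<in> lab v)" unfolding surj[symmetric] by simp
    finally show ?case using lab_All[OF I All.prems] by auto
  qed
qed

theorem refuted_on_Rats:
  assumes w: "w \<in> I" and \<phi>: "\<phi> \<in> Sg" "\<phi> \<notin> lab w"
  shows "\<exists>f. dyn_system Qtop f \<and> \<not> valid_on Qtop f \<phi>"
proof -
  interpret branching_sequences points using branching_points w by blast
  obtain h where h: "bij_betw h points (\<rat> :: real set)"
    and openin_iff: "\<And>U. U \<subseteq> \<rat> \<Longrightarrow> openin Qtop U \<longleftrightarrow>
      (\<forall>x\<in>points. h x \<in> U \<longrightarrow> (\<exists>n. \<forall>y\<in>points. agree n x y \<longrightarrow> h y \<in> U))"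
    using rational_enumeration by metis
  define g where "g = inv_into points h"
  \<comment> \<open>The shift conjugated by the enumeration \<open>h\<close>; \<open>pt\<close>
    reads off the first world of the limit path.\<close>
  define f where "f q = h (shift (g q))" for q
  define pt where "pt q = limit (g q) 0" for q
  have top: "topspace Qtop = \<rat>" unfolding Qtop_def by simp
  have h_Rats: "h x \<in> \<rat>" if "x \<in> points" for x using h that bij_betwE by blast
  have gh [simp]: "g (h x) = x" if "x \<in> points" for x
    unfolding g_def using h that by (simp add: bij_betw_inv_into_left)
  have g: "g q \<in> points" "h (g q) = q" if "q \<in> \<rat>" for q
    using h that unfolding g_def by (auto simp: bij_betw_inv_into_right bij_betw_def inv_into_into)
  have fh: "f (h x) = h (shift x)" if "x \<in> points" for x unfolding f_def using that by simp
  have f: "f q \<in> \<rat>" if "q \<in> \<rat>" for q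
    unfolding f_def using h_Rats shift_points(1) g that by blast
  have fn: "(f ^^ n) q = h ((shift ^^ n) (g q))" if "q \<in> \<rat>" for n q
  proof (induction n)
    case (Suc n)
    then show ?case using fh shift_funpow[OF g(1)[OF that]] by simp
  qed (simp add: g that)
  have "openin Qtop {q \<in> \<rat>. f q \<in> U}" if U: "openin Qtop U" for U
  proof -
    have sub: "U \<subseteq> \<rat>" using openin_subset[OF U] top by simp
    have "\<exists>n. \<forall>y\<in>points. agree n x y \<longrightarrow> h y \<in> {q \<in> \<rat>. f q \<in> U}"
      if x: "x \<in> points" "h x \<in> {q \<in> \<rat>. f q \<in> U}" for x
    proof -
      have "h (shift x) \<in> U" using x fh by simp
      then obtain n where n: "\<And>y. y \<in> points \<Longrightarrow> agree n (shift x) y \<Longrightarrow> h y \<in> U"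
        using openin_iff[OF sub] U shift_points(1)[OF x(1)] by metis
      have "h y \<in> {q \<in> \<rat>. f q \<in> U}" if y: "y \<in> points" "agree (Suc n) x y" for y
        using n[OF shift_points(1)[OF y(1)] shift_agree[OF y(2)]] fh[OF y(1)] h_Rats[OF y(1)] by simp
      then show ?thesis by blast
    qed
    then show ?thesis by (subst openin_iff) auto
  qed
  then have dyn: "dyn_system Qtop f"
    unfolding dyn_system_def continuous_map_def top using f by auto
  let ?V = "\<lambda>p. {q \<in> topspace Qtop. Var p \<in> lab (pt q)}"
  have surj: "pt ` topspace Qtop = I"
  proof
    show "pt ` topspace Qtop \<subseteq> I" unfolding top pt_def using limit_I g(1) by blast
    show "I \<subseteq> pt ` topspace Qtop"
    proof
      fix v assume v: "v \<in> I"
      have r: "realizer v \<in> tame" using realizer[OF v] v unfolding tame_def realizing_def by blast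
      let ?x = "\<lambda>n :: nat. (0 :: nat, realizer v)"
      have "limit ?x = realizer v" using limit_eq[of 0 ?x] by simp
      then have "pt (h ?x) = v" unfolding pt_def using gh[OF points_const[OF r]] realizer[OF v] by simp
      from image_eqI[of v pt "h ?x", OF this[symmetric]] show "v \<in> pt ` topspace Qtop"
        unfolding top using h_Rats[OF points_const[OF r]] .
    qed
  qed
  have truth: "openin Qtop (?V p)" "sem Qtop f ?V \<phi> = {q \<in> topspace Qtop. \<phi> \<in> lab (pt q)}" for p
  proof -
    have A1: "f q \<in> topspace Qtop" if "q \<in> topspace Qtop" for q using f that unfolding top .
    have A2: "S (pt q) (pt (f q))" if "q \<in> topspace Qtop" for q
    proof -
      have gq: "g q \<in> points" using g(1) that unfolding top .
      have "pt (f q) = limit (g q) 1"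
        unfolding pt_def f_def using gh[OF shift_points(1)[OF gq]] shift_points(2)[OF gq] by simp
      then show ?thesis using tame_path[OF limit_tame[OF gq]] unfolding pt_def path_def by simp
    qed
    have A3: "\<exists>U. openin Qtop U \<and> q \<in> U \<and> (\<forall>y\<in>U. le (pt q) (pt y))" if q: "q \<in> topspace Qtop" for q
    proof -
      have gq: "g q \<in> points" "q \<in> \<rat>" using g(1) q unfolding top by auto
      \<comment> \<open>The preimage of an up-set; by transitivity \<open>limit_continuous\<close>
        gives each of its points a cylinder inside it.\<close>
      let ?U = "{y \<in> \<rat>. le (pt q) (pt y)}"
      have "\<exists>n. \<forall>y\<in>points. agree n x y \<longrightarrow> h y \<in> ?U" if x: "x \<in> points" "h x \<in> ?U" for x
      proof -
        obtain n where n: "\<And>y. y \<in> points \<Longrightarrow> agree n x y \<Longrightarrow> le (limit x 0) (limit y 0)"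
          using limit_continuous[OF x(1)] by blast
        have "le (pt q) (limit x 0)" using x unfolding pt_def by simp
        then have "h y \<in> ?U" if "y \<in> points" "agree n x y" for y
          using le_trans[OF _ n[OF that]] h_Rats[OF that(1)] that(1) by (simp add: pt_def)
        then show ?thesis by blast
      qed
      then have "openin Qtop ?U" by (subst openin_iff) auto
      moreover have "q \<in> ?U" using gq le_refl[OF limit_I[OF gq(1)]] unfolding pt_def by simp
      ultimately show ?thesis by blast
    qed
    have A4: "\<exists>y\<in>U. pt y = v" if U: "openin Qtop U" "q \<in> U" and v: "le (pt q) v" for U q v
    proof -
      have sub: "U \<subseteq> \<rat>" using openin_subset[OF U(1)] top by simp
      then have gq: "g q \<in> points" "h (g q) = q" using g U(2) by auto
      then obtain n where n: "\<And>y. y \<in> points \<Longrightarrow> agree n (g q) y \<Longrightarrow> h y \<in> U"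
        using openin_iff[OF sub] U by metis
      obtain y where "y \<in> points" "agree n (g q) y" "limit y 0 = v"
        using limit_open[OF gq(1)] v unfolding pt_def by blast
      then show ?thesis using n[of y] unfolding pt_def by (intro bexI[of _ "h y"]) simp_all
    qed
    have A5: "\<exists>n. a \<in> lab (pt ((f ^^ n) q))"
      if q: "q \<in> topspace Qtop" and a: "Dia a \<in> Sg" "Dia a \<in> lab (pt q)" for q a
    proof -
      have gq: "g q \<in> points" "q \<in> \<rat>" using g(1) q unfolding top by auto
      obtain n where "a \<in> lab (limit (g q) n)"
        using tame_realizing[OF limit_tame[OF gq(1)]] a unfolding realizing_def pt_def by blast
      moreover have "pt ((f ^^ n) q) = limit (g q) n"
        unfolding pt_def fn[OF gq(2)] using shift_funpow[OF gq(1), of n] by simp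
      ultimately show ?thesis by metis
    qed
    show "openin Qtop (?V p)"
      by (rule truth_lemma(1)[of Qtop f pt]) (fact A1 A2 surj A3 A4 A5)+
    show "sem Qtop f ?V \<phi> = {q \<in> topspace Qtop. \<phi> \<in> lab (pt q)}" 
      by (rule truth_lemma(2)[of Qtop f pt]) (fact A1 A2 surj A3 A4 A5 \<phi>)+
  qed
  obtain q where "q \<in> topspace Qtop" "pt q = w" using surj w by blast
  then have "sem Qtop f ?V \<phi> \<noteq> topspace Qtop" unfolding truth(2) using \<phi>(2) by blast
  moreover have "sem Qtop f ?V \<phi> = topspace Qtop" if "valid_on Qtop f \<phi>"
    using that[unfolded valid_on_def, THEN spec[of _ ?V]] truth(1) by simp
  ultimately have "\<not> valid_on Qtop f \<phi>" by blast
  then show ?thesis using dyn by blast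
qed

end

theorem theorem11p8:
  fixes \<phi> :: fml
  assumes "\<forall>f. dyn_system Qtop f \<longrightarrow> valid_on Qtop f \<phi>"
  shows "\<phi> \<in> ITL0"
proof (rule ccontr)
  assume "\<phi> \<notin> ITL0"
  then obtain I :: "moment set" and le S lab w
    where "quasimodel I le S lab (subformulas \<phi>)" and w: "w \<in> I" "\<phi> \<notin> lab w"
    by (rule quasimodel_completeness)
  then interpret quasimodel I le S lab "subformulas \<phi>" by blast
  show False using refuted_on_Rats[OF w(1) subformulas_self w(2)] assms by blast
qed

end
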